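(* Let $N\geq 1$, let $G\in C^2(\mathbb{R})$ be a nonnegative function and let $u\in C^2(\mathbb{R}^N)$ be a stable, nonconstant, bounded solution of $\Delta u=G'(u)$ in $\mathbb{R}^N$. Suppose that there exists $K>0$ such that $-(\sqrt{G})''(s)\geq K$ for every $s\in u(\mathbb{R}^N)$. Then there exist $C,R_0>0$ such that $$\int_{B_R}|\nabla u|^2\,dx\geq C R^{N-1}\quad\text{for all } R\geq R_0.$$
   Context: A solution $u\in C^2(\mathbb{R}^N)$ of $\Delta u=G'(u)$ in $\mathbb{R}^N$ is called stable if $$Q(v):=\int_{\mathbb{R}^N}\left(|\nabla v|^2+G''(u)v^2\right)dx\geq 0$$ for every $v\in C^1(\mathbb{R}^N)$ with compact support in $\mathbb{R}^N$. For $R>0$, $B_R=\{x\in\mathbb{R}^N: |x|<R\}$. By a known theorem of Modica, if $G\in C^2(\mathbb{R})$ is nonnegative and $u$ is a bounded nonconstant solution of $\Delta u=G'(u)$ in $\mathbb{R}^N$, then $G(u(x))>0$ for all $x\in\mathbb{R}^N$. Hence $G>0$ on $u(\mathbb{R}^N)$ (and so on a neighborhood of it), and $(\sqrt{G})''$ is well defined on $u(\mathbb{R}^N)$. *)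

theory Defs
  imports "HOL-Analysis.Analysis"
begin

definition partial_deriv :: "'a::euclidean_space \<Rightarrow> ('a \<Rightarrow> real) \<Rightarrow> 'a \<Rightarrow> real" where
  "partial_deriv b f x = frechet_derivative f (at x) b"

definition grad :: "('a::euclidean_space \<Rightarrow> real) \<Rightarrow> 'a \<Rightarrow> 'a" where
  "grad f x = (\<Sum>b\<in>Basis. partial_deriv b f x *\<^sub>R b)"

definition laplacian :: "('a::euclidean_space \<Rightarrow> real) \<Rightarrow> 'a \<Rightarrow> real" where
  "laplacian f x = (\<Sum>b\<in>Basis. partial_deriv b (partial_deriv b f) x)"

definition C1 :: "('a::euclidean_space \<Rightarrow> real) \<Rightarrow> bool" where
  "C1 f \<longleftrightarrow> (\<forall>x. f differentiable (at x)) \<and> (\<forall>b\<in>Basis. continuous_on UNIV (partial_deriv b f))"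

definition C2 :: "('a::euclidean_space \<Rightarrow> real) \<Rightarrow> bool" where
  "C2 f \<longleftrightarrow> C1 f \<and> (\<forall>b\<in>Basis. C1 (partial_deriv b f))"

lemma gderiv_grad:
  assumes "f differentiable (at x)"
  shows "GDERIV f x :> grad f x"
proof -
  have d: "(f has_derivative frechet_derivative f (at x)) (at x)"
    using assms by (simp add: frechet_derivative_works)
  have "frechet_derivative f (at x) = (\<lambda>h. h \<bullet> grad f x)"
  proof
    fix h
    interpret linear "frechet_derivative f (at x)"
      using d by (rule has_derivative_linear)
    have "frechet_derivative f (at x) h
        = frechet_derivative f (at x) (\<Sum>b\<in>Basis. (h \<bullet> b) *\<^sub>R b)"
      by (simp add: euclidean_representation)
    also have "\<dots> = h \<bullet> grad f x"
      by (simp add: sum scale grad_def partial_deriv_def inner_sum_right mult.commute)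
    finally show "frechet_derivative f (at x) h = h \<bullet> grad f x" .
  qed
  with d show ?thesis
    by (simp add: gderiv_def)
qed

lemma partial_deriv_real:
  fixes f :: "real \<Rightarrow> real"
  assumes "f differentiable (at x)"
  shows "partial_deriv 1 f x = deriv f x"
proof -
  have "(f has_real_derivative deriv f x) (at x)"
    using assms by (metis DERIV_imp_deriv real_differentiable_def)
  then have "frechet_derivative f (at x) = (\<lambda>h. deriv f x * h)"
    by (metis frechet_derivative_at has_field_derivative_def)
  then show ?thesis
    by (simp add: partial_deriv_def)
qed

definition is_solution :: "(real \<Rightarrow> real) \<Rightarrow> ('a::euclidean_space \<Rightarrow> real) \<Rightarrow> bool" where
  "is_solution G u \<longleftrightarrow> C2 u \<and> (\<forall>x. laplacian u x = deriv G (u x))"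

definition second_variation ::
  "(real \<Rightarrow> real) \<Rightarrow> ('a::euclidean_space \<Rightarrow> real) \<Rightarrow> ('a \<Rightarrow> real) \<Rightarrow> real" where
  "second_variation G u v =
     integral\<^sup>L lborel (\<lambda>x. (norm (grad v x))\<^sup>2 + deriv (deriv G) (u x) * (v x)\<^sup>2)"

definition stable_under :: "(real \<Rightarrow> real) \<Rightarrow> ('a::euclidean_space \<Rightarrow> real) \<Rightarrow> bool" where
  "stable_under G u \<longleftrightarrow>
     (\<forall>v. C1 v \<and> compact (closure {x. v x \<noteq> 0}) \<longrightarrow> 0 \<le> second_variation G u v)"

end

theory Submission
  imports Defs
begin

text \<open>Modica's bound \<open>|\<nabla>u|\<^sup>2 \<le> 2 G(u)\<close> is obtained from a maximum principle for
  \<open>v(x) - v(y) - |x - y|\<close>, where \<open>v = H(u)\<close> for a suitable \<open>H\<close>; this uses no regularity beyond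
  \<open>u \<in> C\<^sup>2\<close>. It gives \<open>G(u) > 0\<close> and, with the Pohozaev identity, the monotonicity of
  \<open>R\<^bsup>1-N\<^esup> \<integral> \<zeta>\<^sub>R e\<close>, where \<open>e = |\<nabla>u|\<^sup>2 / 2 + G(u)\<close> and \<open>\<zeta>\<^sub>R\<close> is a cut-off supported in
  the ball of radius \<open>R\<close>. So the full energy grows at least like \<open>R\<^bsup>N-1\<^esup>\<close>, and it remains
  to control \<open>\<integral> \<zeta> G(u)\<close> by the Dirichlet energy. Let \<open>\<phi> = sqrt G\<close>. Stability tested with
  \<open>\<phi>(u) \<eta>\<close>, \<open>\<zeta> = \<eta>\<^sup>2\<close>, and \<open>- \<phi>'' \<ge> K\<close> control \<open>\<integral> \<zeta> G(u)\<^bsup>3/2\<^esup>\<close>, while \<open>\<Delta>u = G'(u)\<close> tested with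
  \<open>G'(u) \<eta>\<^sup>2\<close> controls \<open>\<integral> \<zeta> G'(u)\<^sup>2\<close>, up to an error \<open>O(R\<^bsup>N-2\<^esup>)\<close>. Strict concavity of \<open>\<phi>\<close> yields
  \<open>G \<le> \<alpha> G\<^bsup>3/2\<^esup> + \<beta> G'\<^sup>2\<close> on the range of \<open>u\<close>, which closes the argument.\<close>

subsection \<open>Gradients and second derivatives\<close>

text \<open>Brings functions with an explicitly computed gradient back to \<open>C1\<close> and
  \<open>grad\<close>, the form in which \<open>stable_under\<close> asks for test
  functions.\<close>

lemma C1_of_GDERIV:
  fixes f :: "'a::euclidean_space \<Rightarrow> real"
  assumes f: "\<And>x. GDERIV f x :> g x" and g: "continuous_on UNIV g"
  shows "C1 f" and "grad f = g"
proof -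
  have fd: "frechet_derivative f (at x) = (\<lambda>h. h \<bullet> g x)" for x
    using f[of x] unfolding gderiv_def by (metis frechet_derivative_at)
  have pd: "partial_deriv b f = (\<lambda>x. g x \<bullet> b)" for b
    by (simp add: fun_eq_iff partial_deriv_def fd inner_commute)
  have "f differentiable (at x)" for x
    using f[of x] unfolding gderiv_def differentiable_def by blast
  then show "C1 f"
    unfolding C1_def pd by (auto intro!: continuous_intros g)
  show "grad f = g"
    by (simp add: fun_eq_iff grad_def pd euclidean_representation)
qed

lemma C1_GDERIV: "C1 f \<Longrightarrow> GDERIV f x :> grad f x"
  unfolding C1_def by (blast intro: gderiv_grad)

lemma C1_continuous_grad: "C1 f \<Longrightarrow> continuous_on S (grad f)"
  unfolding C1_def grad_def
  by (rule continuous_on_subset[of UNIV]) (auto intro!: continuous_intros)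

lemma GDERIV_continuous_on:
  assumes "\<And>x. GDERIV f x :> g x"
  shows "continuous_on S f"
  using assms unfolding gderiv_def
  by (meson continuous_at_imp_continuous_on has_derivative_continuous)

lemma partial_deriv_eq_grad: "C1 f \<Longrightarrow> partial_deriv b f x = grad f x \<bullet> b"
  using gderiv_grad[of f x] unfolding C1_def gderiv_def partial_deriv_def
  by (metis frechet_derivative_at inner_commute)

lemma GDERIV_line:
  assumes "GDERIV f (x + t *\<^sub>R h) :> d"
  shows "((\<lambda>t. f (x + t *\<^sub>R h)) has_real_derivative d \<bullet> h) (at t)"
proof -
  have "((\<lambda>t. x + t *\<^sub>R h) has_derivative (\<lambda>s. s *\<^sub>R h)) (at t)"
    by (auto intro!: derivative_eq_intros)
  then have "((\<lambda>t. f (x + t *\<^sub>R h)) has_derivative (\<lambda>s. (s *\<^sub>R h) \<bullet> d)) (at t)"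
    using assms unfolding gderiv_def by (rule has_derivative_compose)
  then show ?thesis
    by (simp add: has_field_derivative_def inner_commute mult.commute[of _ "d \<bullet> h"] mult_commute_abs)
qed

text \<open>Schwarz's theorem: the second difference of \<open>u\<close> over a small parallelogram
  is symmetric in the two increments, and in either order two applications of the mean value theorem
  turn it into a mixed derivative at a nearby point. Continuity does the rest.\<close>

lemma second_partials_symmetric:
  fixes u :: "'a::euclidean_space \<Rightarrow> real"
  assumes u: "\<And>x. GDERIV u x :> p x"
    and b: "\<And>x. GDERIV (\<lambda>x. p x \<bullet> b) x :> qb x" and cb: "continuous_on UNIV qb"
    and c: "\<And>x. GDERIV (\<lambda>x. p x \<bullet> c) x :> qc x" and cc: "continuous_on UNIV qc"
  shows "qb x \<bullet> c = qc x \<bullet> b"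
proof -
  \<comment> \<open>Stated for arbitrary \<open>b\<close>, \<open>c\<close>, \<open>q\<close>, so
    that it can be applied again with the two directions interchanged.\<close>
  have mix: "\<exists>y. norm (y - x) \<le> s * (norm b + norm c) \<and>
      u (x + s *\<^sub>R b + s *\<^sub>R c) - u (x + s *\<^sub>R b) - u (x + s *\<^sub>R c) + u x = s * s * (q y \<bullet> c)"
    if s: "s > 0" and q: "\<And>x. GDERIV (\<lambda>x. p x \<bullet> b) x :> q x" for s :: real and b c and q :: "'a \<Rightarrow> 'a"
  proof -
    define f where "f t = u ((x + s *\<^sub>R c) + t *\<^sub>R b) - u (x + t *\<^sub>R b)" for t
    have "(f has_real_derivative p ((x + s *\<^sub>R c) + t *\<^sub>R b) \<bullet> b - p (x + t *\<^sub>R b) \<bullet> b) (at t)" for t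
      unfolding f_def by (intro DERIV_diff GDERIV_line u)
    from MVT2[of 0 s f, OF s this] obtain t where t: "0 < t" "t < s"
      "f s - f 0 = s * (p ((x + s *\<^sub>R c) + t *\<^sub>R b) \<bullet> b - p (x + t *\<^sub>R b) \<bullet> b)"
      by auto
    define g where "g r = p ((x + t *\<^sub>R b) + r *\<^sub>R c) \<bullet> b" for r
    have "(g has_real_derivative q ((x + t *\<^sub>R b) + r *\<^sub>R c) \<bullet> c) (at r)" for r
      unfolding g_def by (rule GDERIV_line[OF q])
    from MVT2[of 0 s g, OF s this] obtain r where r: "0 < r" "r < s"
      "g s - g 0 = s * (q ((x + t *\<^sub>R b) + r *\<^sub>R c) \<bullet> c)"
      by auto
    have "norm (t *\<^sub>R b + r *\<^sub>R c) \<le> t * norm b + r * norm c"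
      using norm_triangle_ineq[of "t *\<^sub>R b" "r *\<^sub>R c"] t r by simp
    also have "\<dots> \<le> s * (norm b + norm c)"
      using t r by (simp add: distrib_left add_mono mult_right_mono)
    finally have "norm ((x + t *\<^sub>R b) + r *\<^sub>R c - x) \<le> s * (norm b + norm c)"
      by (simp add: algebra_simps)
    moreover have "f s - f 0 = s * (g s - g 0)"
      using t(3) by (simp add: g_def algebra_simps)
    ultimately show ?thesis
      using r(3) by (intro exI[of _ "(x + t *\<^sub>R b) + r *\<^sub>R c"]) (simp add: f_def algebra_simps)
  qed
  define L where "L = norm b + norm c + 1"
  have L: "L > 0" unfolding L_def by (simp add: add_nonneg_pos)
  show ?thesis
  proof (rule ccontr)
    assume ne: "qb x \<bullet> c \<noteq> qc x \<bullet> b"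
    define e where "e = \<bar>qb x \<bullet> c - qc x \<bullet> b\<bar> / 2"
    have e: "e > 0" using ne by (simp add: e_def)
    have "continuous_on UNIV (\<lambda>x. qb x \<bullet> c)" "continuous_on UNIV (\<lambda>x. qc x \<bullet> b)"
      by (auto intro!: continuous_intros cb cc)
    then obtain d1 d2 where d: "d1 > 0" "\<And>y. dist y x < d1 \<Longrightarrow> dist (qb y \<bullet> c) (qb x \<bullet> c) < e"
      "d2 > 0" "\<And>y. dist y x < d2 \<Longrightarrow> dist (qc y \<bullet> b) (qc x \<bullet> b) < e"
      unfolding continuous_on_iff using e by (metis UNIV_I)
    \<comment> \<open>With this step size both intermediate points stay where the continuity
      estimates hold; the summand 1 in \<open>L\<close> keeps the denominator positive when
      \<open>b = c = 0\<close>.\<close>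
    define s where "s = min d1 d2 / (2 * L)"
    have s: "s > 0" using d L by (simp add: s_def)
    have sL: "s * (norm b + norm c) < min d1 d2"
    proof -
      have "s * (norm b + norm c) \<le> s * L" using s by (simp add: L_def)
      also have "\<dots> = min d1 d2 / 2" using L by (simp add: s_def)
      also have "\<dots> < min d1 d2" using d by (auto simp: min_def)
      finally show ?thesis .
    qed
    obtain y where y: "norm (y - x) \<le> s * (norm b + norm c)"
      "u (x + s *\<^sub>R b + s *\<^sub>R c) - u (x + s *\<^sub>R b) - u (x + s *\<^sub>R c) + u x = s * s * (qb y \<bullet> c)"
      using mix[OF s b] by blast
    obtain z where z: "norm (z - x) \<le> s * (norm c + norm b)"
      "u (x + s *\<^sub>R c + s *\<^sub>R b) - u (x + s *\<^sub>R c) - u (x + s *\<^sub>R b) + u x = s * s * (qc z \<bullet> b)"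
      using mix[OF s c] by blast
    have "s * s * (qb y \<bullet> c) = s * s * (qc z \<bullet> b)"
      using y(2) z(2) by (simp add: algebra_simps)
    then have eq: "qb y \<bullet> c = qc z \<bullet> b" using s by simp
    have "dist (qb y \<bullet> c) (qb x \<bullet> c) < e" "dist (qc z \<bullet> b) (qc x \<bullet> b) < e"
      using y(1) z(1) sL d by (auto simp: dist_norm add.commute)
    then show False unfolding eq dist_real_def e_def by (simp add: field_simps abs_if split: if_splits)
  qed
qed

text \<open>If \<open>D > 0\<close>, then \<open>f'\<close> is positive just to the right of the
  critical point 0, and by the mean value theorem \<open>f\<close> would exceed its maximum
  there.\<close>

lemma second_derivative_le_0_at_max:
  fixes f f' :: "real \<Rightarrow> real"
  assumes f: "\<And>t. (f has_real_derivative f' t) (at t)"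
    and f': "(f' has_real_derivative D) (at 0)"
    and max: "\<And>t. f t \<le> f 0"
  shows "D \<le> 0"
proof (rule ccontr)
  assume "\<not> D \<le> 0"
  then have "D > 0" by simp
  have f0: "f' 0 = 0"
    using DERIV_local_max[OF f[of 0], of 1] max by auto
  obtain d where d: "d > 0" "\<And>h. 0 < h \<Longrightarrow> h < d \<Longrightarrow> f' 0 < f' h"
    using DERIV_pos_inc_right[OF f' \<open>D > 0\<close>] by auto
  obtain z where z: "0 < z" "z < d/2" "f (d/2) - f 0 = d/2 * f' z"
    using MVT2[of 0 "d/2" f f'] f d(1) by auto
  have "f' z > 0" using d(2)[of z] z f0 by simp
  then have "f (d/2) > f 0" using z d(1) by (metis diff_gt_0_iff_gt half_gt_zero mult_pos_pos)
  then show False using max[of "d/2"] by simp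
qed

subsection \<open>Modica's gradient bound\<close>

lemma GDERIV_zero_at_max:
  assumes "GDERIV f x :> d" and "\<And>y. f y \<le> f x"
  shows "d = 0"
proof -
  have "((\<lambda>t. f (x + t *\<^sub>R d)) has_real_derivative d \<bullet> d) (at 0)"
    using assms(1) by (intro GDERIV_line) simp
  then have "d \<bullet> d = 0"
    by (rule DERIV_local_max[where d = 1]) (use assms(2) in auto)
  then show ?thesis by simp
qed

lemma GDERIV_norm_diff:
  assumes "x \<noteq> y"
  shows "GDERIV (\<lambda>x. norm (x - y)) x :> sgn (x - y)"
proof -
  have "((\<lambda>x. x - y) has_derivative (\<lambda>h. h)) (at x)"
    by (auto intro!: derivative_eq_intros)
  moreover have "GDERIV norm (x - y) :> sgn (x - y)"
    using assms by (intro GDERIV_norm) auto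
  ultimately show ?thesis
    unfolding gderiv_def by (rule has_derivative_compose)
qed

lemma GDERIV_norm_power2: "GDERIV (\<lambda>x. (norm x)\<^sup>2) x :> 2 *\<^sub>R x"
  unfolding gderiv_def power2_norm_eq_inner
  by (auto intro!: derivative_eq_intros simp: inner_commute)

text \<open>The second-order test moves both points by the same vector, so the term \<open>norm (x - y)\<close>
  contributes nothing and only the sign of the difference of the two Laplacians is used.
  The small penalty \<open>\<tau> |x|\<^sup>2\<close> replaces a compactness argument.\<close>

lemma two_point_maximum_principle:
  fixes v A B :: "'a::euclidean_space \<Rightarrow> real"
  assumes v: "\<And>x. GDERIV v x :> p x"
    and q: "\<And>x b. b \<in> Basis \<Longrightarrow> GDERIV (\<lambda>x. p x \<bullet> b) x :> q b x"
    and eq: "\<And>x. (\<Sum>b\<in>Basis. q b x \<bullet> b) = A x + B x * (1 - (norm (p x))\<^sup>2)"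
    and vM: "\<And>x. \<bar>v x\<bar> \<le> M" and BL: "\<And>x. \<bar>B x\<bar> \<le> L"
    and incr: "\<And>d. d > 0 \<Longrightarrow> \<exists>k>0. \<forall>x y. v x \<ge> v y + d \<longrightarrow> A x \<ge> A y + k"
  shows "v x - v y \<le> norm (x - y)"
proof (rule ccontr)
  assume neg: "\<not> v x - v y \<le> norm (x - y)"
  define d where "d = (v x - v y - norm (x - y)) / 2"
  have d: "d > 0" using neg by (simp add: d_def)
  obtain k where k: "k > 0" "\<And>x y. v x \<ge> v y + d \<Longrightarrow> A x \<ge> A y + k"
    using incr[OF d] by blast
  have M: "M \<ge> 0" and L: "L \<ge> 0" using vM[of 0] BL[of 0] by linarith+
  \<comment> \<open>Wherever the penalised function \<open>P\<close> below is nonnegative,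
    \<open>(s * norm a)^2 \<le> 2 * M\<close>, so \<open>S\<close> bounds \<open>s * norm a\<close>
    uniformly in \<open>s\<close>.\<close>
  define S where "S = sqrt (2 * M)"
  have S: "S \<ge> 0" "S\<^sup>2 = 2 * M" using M by (auto simp: S_def)
  \<comment> \<open>\<open>C\<close> collects the errors caused by the penalty:
    \<open>2 * DIM('a)\<close> from its Laplacian, the rest from the deviation of
    \<open>norm (p a)\<close> from 1. The contradiction will be
    \<open>k \<le> s * C\<close>.\<close>
  define C where "C = 2 * real DIM('a) + L * (4 * S + 4 * S\<^sup>2)"
  have C: "C \<ge> 0" using S(1) L by (simp add: C_def)
  \<comment> \<open>The penalty weight is \<open>s^2\<close>. The three bounds give
    \<open>s^2 \<le> s\<close>, \<open>s * C < k\<close>, and a penalty of at most \<open>d\<close>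
    at the given pair, where \<open>P\<close> therefore is still at least \<open>d\<close>.\<close>
  define s where "s = min 1 (min (k / (2 * (C + 1))) (sqrt d / (norm x + 1)))"
  have s0: "s > 0" unfolding s_def using k(1) C d
    by (auto intro!: divide_pos_pos add_nonneg_pos)
  have s1: "s \<le> 1" unfolding s_def by simp
  have "s \<le> k / (2 * (C + 1))" unfolding s_def by simp
  then have "s * (2 * (C + 1)) \<le> k" using C by (simp add: field_simps)
  moreover have "s * C < s * (2 * (C + 1))" using s0 C by simp
  ultimately have sk: "s * C < k" by linarith
  have "s \<le> sqrt d / (norm x + 1)" unfolding s_def by simp
  then have "s * (norm x + 1) \<le> sqrt d"
    by (metis add_nonneg_pos norm_ge_zero pos_le_divide_eq zero_less_one)
  then have "s * norm x \<le> sqrt d" using s0 by (simp add: distrib_left)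
  then have sx: "(s * norm x)\<^sup>2 \<le> d"
    using s0 d by (metis less_eq_real_def mult_nonneg_nonneg norm_ge_zero power_mono real_sqrt_pow2)
  define P where "P z = v (fst z) - v (snd z) - norm (fst z - snd z) - (s * norm (fst z))\<^sup>2" for z
  have Pd: "P (x, y) \<ge> d" using sx by (simp add: P_def d_def field_simps)
  have bd: "s * norm (fst z) \<le> S" "norm (fst z - snd z) \<le> 2 * M" if "P z \<ge> 0" for z
  proof -
    have a: "norm (fst z - snd z) + (s * norm (fst z))\<^sup>2 \<le> 2 * M"
      using that vM[of "fst z"] vM[of "snd z"] unfolding P_def by linarith
    have "(s * norm (fst z))\<^sup>2 \<le> S\<^sup>2"
      using a norm_ge_zero[of "fst z - snd z"] unfolding S(2) by linarith
    then show "s * norm (fst z) \<le> S" using S(1) by (rule power2_le_imp_le)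
    show "norm (fst z - snd z) \<le> 2 * M"
      using a zero_le_power2[of "s * norm (fst z)"] by linarith
  qed
  \<comment> \<open>All points with \<open>P \<ge> 0\<close> lie in this compact set, so the maximum
    over it is global.\<close>
  define K where "K = cball (0::'a) (S / s) \<times> cball (0::'a) (S / s + 2 * M)"
  have inK: "z \<in> K" if "P z \<ge> 0" for z
  proof -
    have "norm (fst z) \<le> S / s" using bd(1)[OF that] s0 by (simp add: field_simps)
    moreover have "norm (snd z) \<le> norm (fst z) + norm (fst z - snd z)"
      by (metis add.commute norm_minus_commute norm_triangle_sub)
    ultimately show ?thesis using bd(2)[OF that] by (cases z) (auto simp: K_def)
  qed
  have cv: "continuous_on T v" for T using v by (rule GDERIV_continuous_on)
  have cP: "continuous_on K P" unfolding P_def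
    by (intro continuous_intros continuous_on_compose2[OF cv[of UNIV]]) auto
  have "compact K" unfolding K_def by (intro compact_Times compact_cball)
  moreover have "K \<noteq> {}" using inK[of "(x, y)"] Pd d by auto
  ultimately obtain z0 where z0: "z0 \<in> K" "\<And>z. z \<in> K \<Longrightarrow> P z \<le> P z0"
    using continuous_attains_sup[OF _ _ cP] by blast
  obtain a c where ac: "z0 = (a, c)" by (cases z0)
  have Pz0: "P (a, c) \<ge> d" using z0(2)[OF inK[of "(x, y)"]] Pd d ac by simp
  have Pmax: "P z \<le> P (a, c)" for z
  proof (cases "P z \<ge> 0")
    case True then show ?thesis using z0(2)[OF inK] ac by simp
  next
    case False then show ?thesis using Pz0 d by simp
  qed
  have sa: "s * norm a \<le> S" using bd(1)[of "(a, c)"] Pz0 d by simp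
  have vac: "v a \<ge> v c + d"
    using Pz0 norm_ge_zero[of "a - c"] zero_le_power2[of "s * norm a"]
    unfolding P_def fst_conv snd_conv by linarith
  then have "a \<noteq> c" using d by auto
  define e where "e = sgn (a - c)"
  have e: "norm e = 1" using \<open>a \<noteq> c\<close> by (simp add: e_def norm_sgn)
  \<comment> \<open>First-order conditions in each variable separately: \<open>p c\<close> is
    exactly the unit vector \<open>e\<close>, so the \<open>B\<close>-term vanishes at
    \<open>c\<close>, while \<open>p a\<close> differs from \<open>e\<close> by
    \<open>2 * s^2\<close> times \<open>a\<close>.\<close>
  have "GDERIV (\<lambda>x. v x - v c - norm (x - c) - s\<^sup>2 * (norm x)\<^sup>2) a
      :> p a - 0 - e - (s\<^sup>2 *\<^sub>R (2 *\<^sub>R a) + (norm a)\<^sup>2 *\<^sub>R 0)"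
    unfolding e_def using \<open>a \<noteq> c\<close>
    by (intro GDERIV_diff GDERIV_mult GDERIV_const GDERIV_norm_diff GDERIV_norm_power2 v)
  then have "p a - 0 - e - (s\<^sup>2 *\<^sub>R (2 *\<^sub>R a) + (norm a)\<^sup>2 *\<^sub>R 0) = 0"
    by (rule GDERIV_zero_at_max)
       (use Pmax[of "(_, c)"] in \<open>simp add: P_def power_mult_distrib\<close>)
  then have pa: "p a = e + (2 * s\<^sup>2) *\<^sub>R a" by (simp add: algebra_simps)
  have "GDERIV (\<lambda>y. v a - v y - norm (y - a) - s\<^sup>2 * (norm a)\<^sup>2) c :> 0 - p c - sgn (c - a) - 0"
    using \<open>a \<noteq> c\<close> by (intro GDERIV_diff GDERIV_const GDERIV_norm_diff v) auto
  then have "0 - p c - sgn (c - a) - 0 = 0"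
    by (rule GDERIV_zero_at_max)
       (use Pmax[of "(a, _)"] in \<open>simp add: P_def power_mult_distrib norm_minus_commute\<close>)
  moreover have "sgn (c - a) = - e" by (metis e_def minus_diff_eq sgn_minus)
  ultimately have pc: "p c = e" by simp
  have second: "q b a \<bullet> b - q b c \<bullet> b \<le> 2 * s\<^sup>2" if b: "b \<in> Basis" for b
  proof -
    define f where "f t = v (a + t *\<^sub>R b) - v (c + t *\<^sub>R b) - s\<^sup>2 * (norm (a + t *\<^sub>R b))\<^sup>2" for t
    define f' where "f' t = p (a + t *\<^sub>R b) \<bullet> b - p (c + t *\<^sub>R b) \<bullet> b - s\<^sup>2 * ((2 *\<^sub>R (a + t *\<^sub>R b)) \<bullet> b)" for t
    have "(f has_real_derivative f' t) (at t)" for t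
      unfolding f_def f'_def by (intro DERIV_diff DERIV_cmult GDERIV_line v GDERIV_norm_power2)
    moreover have "(f' has_real_derivative q b a \<bullet> b - q b c \<bullet> b - s\<^sup>2 * (2 * (b \<bullet> b))) (at 0)"
      unfolding f'_def
      by (intro DERIV_diff DERIV_cmult GDERIV_line)
         (auto intro!: q b derivative_eq_intros simp: inner_add_left)
    moreover have "f t \<le> f 0" for t
      using Pmax[of "(a + t *\<^sub>R b, c + t *\<^sub>R b)"] by (simp add: f_def P_def power_mult_distrib)
    ultimately have "q b a \<bullet> b - q b c \<bullet> b - s\<^sup>2 * (2 * (b \<bullet> b)) \<le> 0"
      by (rule second_derivative_le_0_at_max)
    then show ?thesis using b by (simp add: inner_Basis)
  qed
  have "(\<Sum>b\<in>Basis. q b a \<bullet> b - q b c \<bullet> b) \<le> (\<Sum>b\<in>(Basis::'a set). 2 * s\<^sup>2)"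
    by (intro sum_mono second)
  then have "A a + B a * (1 - (norm (p a))\<^sup>2) - A c \<le> real DIM('a) * (2 * s\<^sup>2)"
    by (simp add: sum_subtractf eq pc e)
  moreover have "s\<^sup>2 \<le> s" using s0 s1 by (simp add: power2_eq_square mult_left_le)
  ultimately have lap: "A a + B a * (1 - (norm (p a))\<^sup>2) - A c \<le> real DIM('a) * (2 * s)"
    by (smt (verit) mult_left_mono of_nat_0_le_iff)
  have n2: "(norm (p a))\<^sup>2 = 1 + 4 * s * (s * (e \<bullet> a)) + 4 * s\<^sup>2 * (s * norm a)\<^sup>2"
  proof -
    have ee: "e \<bullet> e = 1" using e by (simp add: norm_eq_1)
    have "(norm (p a))\<^sup>2 = (e + (2 * s\<^sup>2) *\<^sub>R a) \<bullet> (e + (2 * s\<^sup>2) *\<^sub>R a)"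
      by (simp add: pa power2_norm_eq_inner)
    also have "\<dots> = 1 + 4 * s * (s * (e \<bullet> a)) + 4 * s\<^sup>2 * (s\<^sup>2 * (a \<bullet> a))"
      by (simp add: inner_add_left inner_add_right ee inner_commute[of a e] power2_eq_square algebra_simps)
    finally show ?thesis by (simp add: power_mult_distrib power2_norm_eq_inner)
  qed
  have "\<bar>s * (e \<bullet> a)\<bar> \<le> s * norm a"
    using Cauchy_Schwarz_ineq2[of e a] e s0 by (simp add: abs_mult)
  then have "4 * s * \<bar>s * (e \<bullet> a)\<bar> \<le> 4 * s * S"
    using sa s0 by (intro mult_left_mono) auto
  then have i1: "\<bar>4 * s * (s * (e \<bullet> a))\<bar> \<le> 4 * s * S"
    using s0 by (simp add: abs_mult)
  have i2: "4 * s\<^sup>2 * (s * norm a)\<^sup>2 \<le> 4 * s * S\<^sup>2"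
    using \<open>s\<^sup>2 \<le> s\<close> sa s0 by (intro mult_mono power_mono) auto
  have i3: "0 \<le> 4 * s\<^sup>2 * (s * norm a)\<^sup>2" by simp
  have "\<bar>1 - (norm (p a))\<^sup>2\<bar> \<le> s * (4 * S + 4 * S\<^sup>2)"
  proof -
    have "s * (4 * S + 4 * S\<^sup>2) = 4 * s * S + 4 * s * S\<^sup>2" by (simp add: algebra_simps)
    then show ?thesis unfolding n2 using i1 i2 i3 by linarith
  qed
  then have "\<bar>B a * (1 - (norm (p a))\<^sup>2)\<bar> \<le> L * (s * (4 * S + 4 * S\<^sup>2))"
    using BL[of a] L unfolding abs_mult by (intro mult_mono) auto
  moreover have "A a \<ge> A c + k" using k(2)[OF vac] .
  ultimately have "k \<le> s * C" using lap unfolding C_def by (simp add: algebra_simps abs_le_iff)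
  then show False using sk by simp
qed

text \<open>If \<open>norm d > 1\<close>, moving along \<open>d\<close> itself would increase
  \<open>f\<close> faster than the distance covered.\<close>

lemma GDERIV_norm_le:
  assumes f: "GDERIV f x :> d" and lip: "\<And>y. f y - f x \<le> norm (y - x)"
  shows "norm d \<le> 1"
proof (rule ccontr)
  assume "\<not> norm d \<le> 1"
  then have "norm d * (norm d - 1) > 0" by (intro mult_pos_pos) auto
  then have pos: "d \<bullet> d - norm d > 0"
    by (simp add: power2_norm_eq_inner[symmetric] power2_eq_square algebra_simps)
  have "((\<lambda>t. f (x + t *\<^sub>R d) - t * norm d) has_real_derivative d \<bullet> d - norm d) (at 0)"
    using f by (intro DERIV_diff GDERIV_line) (auto intro!: derivative_eq_intros)
  from DERIV_pos_inc_right[OF this pos] obtain e where e: "e > 0"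
    "\<And>h. 0 < h \<Longrightarrow> h < e \<Longrightarrow> f x < f (x + h *\<^sub>R d) - h * norm d" by auto
  show False using e(2)[of "e/2"] lip[of "x + (e/2) *\<^sub>R d"] e(1) by simp
qed

lemma continuous_bounded_on_interval:
  fixes f :: "real \<Rightarrow> real"
  assumes "continuous_on {a..b} f"
  obtains B where "B \<ge> 0" "\<And>s. s \<in> {a..b} \<Longrightarrow> \<bar>f s\<bar> \<le> B"
proof -
  have "bounded (f ` {a..b})"
    using assms by (intro compact_imp_bounded compact_continuous_image) auto
  then show ?thesis using that unfolding bounded_pos by (metis imageI less_eq_real_def real_norm_def)
qed

text \<open>The function \<open>F\<close> below majorises \<open>G\<close> by at most \<open>2 c\<close>, and in the variable \<open>v = H u\<close> with
  \<open>H' = 1 / sqrt (2 F)\<close> the equation becomes \<open>\<Delta>v = A + B (1 - |\<nabla>v|\<^sup>2)\<close> where the exponential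
  in \<open>F\<close> makes \<open>A = - c \<Lambda> E / sqrt (2 F)\<close> strictly increasing as a function of \<open>u\<close>.\<close>

theorem modica_gradient_bound:
  fixes u :: "'a::euclidean_space \<Rightarrow> real"
  assumes u: "\<And>x. GDERIV u x :> p x"
    and q: "\<And>x b. b \<in> Basis \<Longrightarrow> GDERIV (\<lambda>x. p x \<bullet> b) x :> q b x"
    and eq: "\<And>x. (\<Sum>b\<in>Basis. q b x \<bullet> b) = g (u x)"
    and G: "\<And>s. DERIV G s :> g s" and g: "continuous_on UNIV g" and G0: "\<And>s. G s \<ge> 0"
    and uM: "\<And>x. \<bar>u x\<bar> \<le> M"
  shows "(norm (p x))\<^sup>2 \<le> 2 * G (u x)"
proof (rule field_le_epsilon)
  fix e :: real assume "e > 0"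
  \<comment> \<open>As \<open>F\<close> exceeds \<open>G\<close> by at most \<open>2 * c\<close>,
    this yields \<open>2 * F \<le> 2 * G + e\<close> at the end.\<close>
  define c where "c = e / 4"
  have c: "c > 0" using \<open>e > 0\<close> by (simp add: c_def)
  \<comment> \<open>The extra 1 keeps the range of \<open>u\<close> inside the open interval, where
    \<open>H\<close> has a two-sided derivative.\<close>
  define m where "m = M + 1"
  have um: "- m < u x" "u x < m" for x using uM[of x] unfolding m_def by linarith+
  then have uJ: "u x \<in> {-m..m}" for x by (simp add: less_imp_le)
  have cg: "continuous_on {-m..m} g" using g by (rule continuous_on_subset) auto
  have cG: "continuous_on {-m..m} G" using G by (meson DERIV_continuous_on has_field_derivative_at_within)
  obtain \<Gamma> where \<Gamma>: "\<Gamma> \<ge> 0" "\<And>s. s \<in> {-m..m} \<Longrightarrow> \<bar>g s\<bar> \<le> \<Gamma>"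
    using continuous_bounded_on_interval[OF cg] by blast
  obtain Gm where Gm: "Gm \<ge> 0" "\<And>s. s \<in> {-m..m} \<Longrightarrow> \<bar>G s\<bar> \<le> Gm"
    using continuous_bounded_on_interval[OF cG] by blast
  \<comment> \<open>Since \<open>- F' \<le> \<Gamma>\<close> and \<open>F \<ge> c\<close>, this
    choice gives \<open>\<Lambda> + F' / (2 * F) \<ge> 1\<close>, which makes \<open>A\<close>
    increase at a definite rate.\<close>
  define \<Lambda> where "\<Lambda> = 1 + \<Gamma> / (2 * c)"
  have \<Lambda>: "\<Lambda> \<ge> 1" using \<Gamma>(1) c by (simp add: \<Lambda>_def)
  define E where "E s = exp (- \<Lambda> * (s + m))" for s
  have E: "0 < E s" "E s \<le> 1" "E m \<le> E s" if "s \<in> {-m..m}" for s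
    using that \<Lambda> by (auto simp: E_def)
  have dE: "DERIV E s :> - \<Lambda> * E s" for s
    unfolding E_def by (auto intro!: derivative_eq_intros)
  define F where "F s = G s + c * (2 - E s)" for s
  define F' where "F' s = g s + c * \<Lambda> * E s" for s
  have dF: "DERIV F s :> F' s" for s
    unfolding F_def F'_def by (auto intro!: derivative_eq_intros G dE)
  have Fc: "c \<le> F s" "F s \<le> Gm + 2 * c" "F s \<le> G s + 2 * c" if s: "s \<in> {-m..m}" for s
  proof -
    have "c * 1 \<le> c * (2 - E s)" "c * (2 - E s) \<le> c * 2"
      using c E[OF s] by (auto simp del: mult_1_right)
    then show "c \<le> F s" "F s \<le> Gm + 2 * c" "F s \<le> G s + 2 * c"
      using G0[of s] Gm(2)[OF s] unfolding F_def by linarith+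
  qed
  have F0: "F s > 0" if "s \<in> {-m..m}" for s using Fc(1)[OF that] c by simp
  define w where "w s = 1 / sqrt (2 * F s)" for s
  define w' where "w' s = - F' s * w s / (2 * F s)" for s
  have w0: "w s > 0" "(w s)\<^sup>2 = 1 / (2 * F s)" "w s \<le> 1 / sqrt (2 * c)"
    "1 / sqrt (2 * (Gm + 2 * c)) \<le> w s" if s: "s \<in> {-m..m}" for s
  proof -
    show "w s > 0" "(w s)\<^sup>2 = 1 / (2 * F s)" using F0[OF s] by (simp_all add: w_def power_divide)
    show "w s \<le> 1 / sqrt (2 * c)" unfolding w_def using Fc(1)[OF s] c F0[OF s]
      by (intro divide_left_mono) auto
    show "1 / sqrt (2 * (Gm + 2 * c)) \<le> w s" unfolding w_def using Fc(2)[OF s] F0[OF s] c Gm(1)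
      by (intro divide_left_mono) auto
  qed
  have dw: "DERIV w s :> w' s" if s: "s \<in> {-m..m}" for s
  proof -
    have "DERIV (\<lambda>s. sqrt (2 * F s)) s :> (inverse (sqrt (2 * F s)) / 2) * (2 * F' s)"
      using F0[OF s] by (intro DERIV_chain2[OF DERIV_real_sqrt] DERIV_cmult dF) auto
    then have "DERIV (\<lambda>s. 1 / sqrt (2 * F s)) s :>
        (0 * sqrt (2 * F s) - 1 * ((inverse (sqrt (2 * F s)) / 2) * (2 * F' s)))
          / (sqrt (2 * F s) * sqrt (2 * F s))"
      using F0[OF s] by (intro DERIV_divide DERIV_const) auto
    then show ?thesis unfolding w_def w'_def using F0[OF s] by (simp add: field_simps)
  qed
  have cw: "continuous_on {-m..m} w"
    using dw by (meson DERIV_continuous_on has_field_derivative_at_within)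
  define H where "H s = integral {-m..s} w" for s
  have dH: "DERIV H s :> w s" if s: "-m < s" "s < m" for s
  proof -
    have "(H has_real_derivative w s) (at s within {-m..m})"
      unfolding H_def using s by (intro integral_has_real_derivative cw) auto
    then show ?thesis using s by (simp add: at_within_Icc_at)
  qed
  have cH: "continuous_on {-m..m} H"
    unfolding H_def by (intro indefinite_integral_continuous_1 integrable_continuous_real cw)
  obtain V where V: "\<And>s. s \<in> {-m..m} \<Longrightarrow> \<bar>H s\<bar> \<le> V"
    using continuous_bounded_on_interval[OF cH] by blast
  define pv where "pv x = w (u x) *\<^sub>R p x" for x
  define qv where "qv b x = w (u x) *\<^sub>R q b x + (p x \<bullet> b) *\<^sub>R (w' (u x) *\<^sub>R p x)" for b x
  define A where "A s = - c * \<Lambda> * (E s * w s)" for s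
  define B where "B s = F' s * w s" for s
  have lip: "H (u x) - H (u y) \<le> norm (x - y)" for x y
  proof (rule two_point_maximum_principle[where p = pv and q = qv and A = "\<lambda>x. A (u x)"
        and B = "\<lambda>x. B (u x)" and M = V and L = "(\<Gamma> + c * \<Lambda>) * (1 / sqrt (2 * c))"])
    show "GDERIV (\<lambda>x. H (u x)) x :> pv x" for x
      unfolding pv_def by (rule GDERIV_DERIV_compose[OF u dH[OF um]])
    show "GDERIV (\<lambda>x. pv x \<bullet> b) x :> qv b x" if "b \<in> Basis" for x b
      unfolding pv_def qv_def inner_scaleR_left
      by (intro GDERIV_mult q that GDERIV_DERIV_compose[OF u dw[OF uJ]])
    show "(\<Sum>b\<in>Basis. qv b x \<bullet> b) = A (u x) + B (u x) * (1 - (norm (pv x))\<^sup>2)" for x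
    proof -
      have "(norm (p x))\<^sup>2 = (\<Sum>b\<in>Basis. (p x \<bullet> b) * (p x \<bullet> b))"
        by (simp add: power2_norm_eq_inner euclidean_inner[symmetric])
      then have "(\<Sum>b\<in>Basis. qv b x \<bullet> b) = w (u x) * g (u x) + w' (u x) * (norm (p x))\<^sup>2"
        by (simp add: qv_def inner_add_left sum.distrib eq[symmetric] sum_distrib_left algebra_simps)
      \<comment> \<open>Insert \<open>g = F' - c * \<Lambda> * E\<close> and
        \<open>w' = - F' * w ^ 3\<close>.\<close>
      also have "\<dots> = A (u x) + B (u x) * (1 - (w (u x))\<^sup>2 * (norm (p x))\<^sup>2)"
        unfolding w0(2)[OF uJ] A_def B_def w'_def F'_def
        using F0[OF uJ[of x]] by (simp add: field_simps)
      finally show ?thesis by (simp add: pv_def power_mult_distrib)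
    qed
    show "\<bar>H (u x)\<bar> \<le> V" for x using V[OF uJ] .
    show "\<bar>B (u x)\<bar> \<le> (\<Gamma> + c * \<Lambda>) * (1 / sqrt (2 * c))" for x
    proof -
      have "c * \<Lambda> * E (u x) \<le> c * \<Lambda> * 1"
        using c \<Lambda> E(2)[OF uJ[of x]] by (intro mult_left_mono) auto
      moreover have "0 \<le> c * \<Lambda> * E (u x)" using c \<Lambda> E(1)[OF uJ[of x]] by simp
      ultimately have "\<bar>F' (u x)\<bar> \<le> \<Gamma> + c * \<Lambda>"
        using \<Gamma>(2)[OF uJ[of x]] unfolding F'_def by linarith
      then show ?thesis
        unfolding B_def abs_mult using w0(1,3)[OF uJ[of x]] c \<Lambda> \<Gamma>(1)
        by (intro mult_mono) (auto intro: add_nonneg_nonneg)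
    qed
    fix d :: real assume d: "d > 0"
    \<comment> \<open>\<open>k1\<close> bounds \<open>A'\<close> from below. As
      \<open>H' \<le> 1 / sqrt (2 * c)\<close>, a gap \<open>d\<close> in \<open>H\<close> forces a
      gap of at least \<open>d * sqrt (2 * c)\<close> in \<open>u\<close>; the product
      \<open>k\<close> is then a lower bound for the gap in \<open>A\<close>.\<close>
    define k1 where "k1 = c * \<Lambda> * (E m * (1 / sqrt (2 * (Gm + 2 * c))))"
    have k1: "k1 > 0" unfolding k1_def using c \<Lambda> Gm(1) by (simp add: E_def)
    define k where "k = (d * sqrt (2 * c)) * k1"
    have "k > 0" unfolding k_def using d c k1 by simp
    moreover have "A (u x) \<ge> A (u y) + k" if vd: "H (u x) \<ge> H (u y) + d" for x y
    proof -
      have "u y < u x"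
      proof (rule ccontr)
        assume "\<not> u y < u x"
        then have xy: "u x \<le> u y" by simp
        have "H (u x) \<le> H (u y)"
        proof (rule DERIV_nonneg_imp_nondecreasing[OF xy])
          fix t assume "u x \<le> t" "t \<le> u y"
          then have "-m < t" "t < m" using um(1)[of x] um(2)[of y] by linarith+
          then show "\<exists>d. DERIV H t :> d \<and> d \<ge> 0"
            using dH[of t] w0(1)[of t] by (intro exI[of _ "w t"]) auto
        qed
        then show False using vd d by simp
      qed
      have mid: "-m < t" "t < m" "t \<in> {-m..m}" if "u y \<le> t" "t \<le> u x" for t
        using that um(1)[of y] um(2)[of x] by auto
      obtain t where t: "u y < t" "t < u x" "H (u x) - H (u y) = (u x - u y) * w t"
        using MVT2[OF \<open>u y < u x\<close>, of H w] dH mid(1,2) by auto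
      have "(u x - u y) * w t \<le> (u x - u y) * (1 / sqrt (2 * c))"
        using t(1,2) w0(3)[OF mid(3)[of t]] by (intro mult_left_mono) auto
      then have "d \<le> (u x - u y) / sqrt (2 * c)" using t(3) vd by simp
      then have ud: "d * sqrt (2 * c) \<le> u x - u y" using c by (simp add: field_simps)
      define A' where "A' s = - c * \<Lambda> * ((- \<Lambda> * E s) * w s + w' s * E s)" for s
      have "DERIV A s :> A' s" if "s \<in> {-m..m}" for s
        unfolding A_def A'_def by (intro DERIV_cmult DERIV_mult dE dw that)
      then obtain r where r: "u y < r" "r < u x" "A (u x) - A (u y) = (u x - u y) * A' r"
        using MVT2[OF \<open>u y < u x\<close>, of A A'] mid(3) by auto
      have rJ: "r \<in> {-m..m}" using mid(3) r by simp
      have "0 \<le> c * \<Lambda> * E r" using c \<Lambda> E(1)[OF rJ] by simp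
      then have "- F' r \<le> \<Gamma>" using \<Gamma>(2)[OF rJ] unfolding F'_def by linarith
      then have "- F' r / (2 * F r) \<le> \<Gamma> / (2 * F r)"
        using F0[OF rJ] by (intro divide_right_mono) auto
      also have "\<dots> \<le> \<Gamma> / (2 * c)"
        using \<Gamma>(1) Fc(1)[OF rJ] c F0[OF rJ] by (intro divide_left_mono) auto
      finally have "1 \<le> \<Lambda> + F' r / (2 * F r)" by (simp add: \<Lambda>_def)
      moreover have "k1 \<le> c * \<Lambda> * (E r * w r)" unfolding k1_def
        using c \<Lambda> E[OF rJ] w0(1,4)[OF rJ] Gm(1) by (intro mult_left_mono mult_mono) auto
      ultimately have "k1 * 1 \<le> (c * \<Lambda> * (E r * w r)) * (\<Lambda> + F' r / (2 * F r))"
        using k1 by (intro mult_mono) auto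
      also have "\<dots> = A' r" by (simp add: A'_def w'_def algebra_simps)
      finally have "(d * sqrt (2 * c)) * k1 \<le> (u x - u y) * A' r"
        using ud k1 d c t(1,2) by (intro mult_mono) auto
      then show ?thesis using r(3) by (simp add: k_def)
    qed
    ultimately show "\<exists>k>0. \<forall>x y. H (u x) \<ge> H (u y) + d \<longrightarrow> A (u x) \<ge> A (u y) + k" by blast
  qed
  have "GDERIV (\<lambda>x. H (u x)) x :> pv x"
    unfolding pv_def by (rule GDERIV_DERIV_compose[OF u dH[OF um]])
  then have "norm (pv x) \<le> 1" using lip by (rule GDERIV_norm_le)
  then have "(norm (pv x))\<^sup>2 \<le> 1\<^sup>2" by (intro power_mono) auto
  then have "(norm (p x))\<^sup>2 \<le> 2 * F (u x)"
    using F0[OF uJ[of x]] by (simp add: pv_def power_mult_distrib w0(2)[OF uJ])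
  then show "(norm (p x))\<^sup>2 \<le> 2 * G (u x) + e"
    using Fc(3)[OF uJ[of x]] by (simp add: c_def)
qed

subsection \<open>Integration by parts\<close>

lemma GDERIV_sum:
  "finite S \<Longrightarrow> (\<And>i. i \<in> S \<Longrightarrow> GDERIV (f i) x :> d i)
    \<Longrightarrow> GDERIV (\<lambda>x. \<Sum>i\<in>S. f i x) x :> (\<Sum>i\<in>S. d i)"
  by (induction S rule: finite_induct) (auto intro!: GDERIV_add GDERIV_const)

lemma integrable_compact_support:
  fixes f :: "'a::euclidean_space \<Rightarrow> real"
  assumes "continuous_on UNIV f" and "\<And>x. norm x > r \<Longrightarrow> f x = 0"
  shows "integrable lborel f"
proof -
  have "integrable lborel (\<lambda>x. indicator (cball 0 r) x *\<^sub>R f x)"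
    using assms(1) by (intro borel_integrable_compact) (auto intro: continuous_on_subset)
  also have "(\<lambda>x. indicator (cball 0 r) x *\<^sub>R f x) = f"
    using assms(2) by (auto simp: fun_eq_iff indicator_def not_le)
  finally show ?thesis .
qed

lemma integral_lborel_translate:
  fixes f :: "'a::euclidean_space \<Rightarrow> real"
  assumes "f \<in> borel_measurable borel"
  shows "(\<integral>x. f (x + c) \<partial>lborel) = (\<integral>x. f x \<partial>lborel)"
proof -
  have "(\<integral>x. f x \<partial>distr lborel borel ((+) c)) = (\<integral>x. f (c + x) \<partial>lborel)"
    using assms by (intro integral_distr) auto
  then show ?thesis by (simp add: lborel_distr_plus add.commute)
qed

lemma GDERIV_0_outside:
  fixes f :: "'a::euclidean_space \<Rightarrow> real"
  assumes f: "GDERIV f x :> d" and 0: "\<And>x. norm x > r \<Longrightarrow> f x = 0" and x: "norm x > r"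
  shows "d = 0"
proof -
  have op: "open {x::'a. r < norm x}" by (intro open_Collect_less continuous_intros)
  have "GDERIV f x :> 0"
    unfolding gderiv_def
    by (rule has_derivative_transform_within_open[OF _ op, of "\<lambda>_. 0"]) (use x 0 in auto)
  then have "(\<lambda>h. h \<bullet> d) = (\<lambda>h. h \<bullet> (0::'a))"
    using f unfolding gderiv_def by (rule has_derivative_unique[symmetric])
  then have "d \<bullet> d = d \<bullet> 0" by metis
  then show ?thesis by simp
qed

text \<open>Difference quotients of \<open>f\<close> integrate to 0 by translation invariance of
  Lebesgue measure, and dominated convergence carries this over to the derivative.\<close>

lemma integral_directional_derivative_0:
  fixes f :: "'a::euclidean_space \<Rightarrow> real"
  assumes f: "\<And>x. GDERIV f x :> d x" and d: "continuous_on UNIV d"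
    and 0: "\<And>x. norm x > r \<Longrightarrow> f x = 0"
  shows "(\<integral>x. d x \<bullet> b \<partial>lborel) = 0"
proof -
  have d0: "d x = 0" if "norm x > r" for x using GDERIV_0_outside[OF f 0 that] .
  have cf: "continuous_on UNIV f" using f by (rule GDERIV_continuous_on)
  have "bounded ((\<lambda>x. d x \<bullet> b) ` cball 0 r)"
    by (intro compact_imp_bounded compact_continuous_image continuous_intros continuous_on_subset[OF d]) auto
  then obtain D where D: "D > 0" "\<And>x. x \<in> cball 0 r \<Longrightarrow> \<bar>d x \<bullet> b\<bar> \<le> D"
    unfolding bounded_pos by auto
  have D': "\<bar>d x \<bullet> b\<bar> \<le> D" for x
    using D d0[of x] by (cases "norm x \<le> r") auto
  define s where "s n x = (f (x + (1 / Suc n) *\<^sub>R b) - f x) / (1 / Suc n)" for n and x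
  have sb: "\<bar>s n x\<bar> \<le> D" for n x
  proof -
    have "((\<lambda>t. f (x + t *\<^sub>R b)) has_real_derivative d (x + t *\<^sub>R b) \<bullet> b) (at t)" for t
      by (intro GDERIV_line f)
    from MVT2[of 0 "1 / real (Suc n)", OF _ this] obtain t where
      "f (x + (1 / Suc n) *\<^sub>R b) - f x = (1 / Suc n) * (d (x + t *\<^sub>R b) \<bullet> b)" by auto
    then show ?thesis unfolding s_def using D'[of "x + t *\<^sub>R b"] by simp
  qed
  \<comment> \<open>The steps are at most 1, so all quotients vanish outside one ball, and the
    constant \<open>D\<close> on that ball is an integrable majorant.\<close>
  have s0: "s n x = 0" if "norm x > r + norm b" for n x
  proof -
    have "norm x \<le> norm (x + (1 / Suc n) *\<^sub>R b) + norm ((1 / Suc n) *\<^sub>R b)"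
      by (metis add_diff_cancel_right' norm_triangle_ineq4)
    moreover have "norm ((1 / Suc n) *\<^sub>R b) \<le> norm b" by (simp add: field_simps)
    ultimately have "norm (x + (1 / Suc n) *\<^sub>R b) > r" using that by linarith
    moreover have "norm x > r" using that norm_ge_zero[of b] by linarith
    ultimately show ?thesis by (simp add: s_def 0)
  qed
  have lim: "(\<lambda>n. s n x) \<longlonglongrightarrow> d x \<bullet> b" for x
  proof -
    have "((\<lambda>t. f (x + t *\<^sub>R b)) has_real_derivative d x \<bullet> b) (at 0)"
      by (intro GDERIV_line) (simp add: f)
    then have *: "(\<lambda>t. (f (x + t *\<^sub>R b) - f x) / t) \<midarrow>0\<rightarrow> d x \<bullet> b"
      by (simp add: DERIV_def)
    have "filterlim (\<lambda>n. 1 / real (Suc n)) (at 0) sequentially"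
      unfolding filterlim_at using LIMSEQ_inverse_real_of_nat by (auto simp: inverse_eq_divide)
    from filterlim_compose[OF * this] show ?thesis by (simp add: s_def)
  qed
  have ms: "s n \<in> borel_measurable lborel" for n
    unfolding s_def measurable_lborel2
    by (intro borel_measurable_continuous_onI continuous_intros continuous_on_compose2[OF cf]) auto
  have "(\<lambda>n. \<integral>x. s n x \<partial>lborel) \<longlonglongrightarrow> (\<integral>x. d x \<bullet> b \<partial>lborel)"
  proof (rule integral_dominated_convergence)
    show "(\<lambda>x. d x \<bullet> b) \<in> borel_measurable lborel" unfolding measurable_lborel2
      by (intro borel_measurable_continuous_onI continuous_intros d)
    show "integrable lborel (\<lambda>x. indicator (cball 0 (r + norm b)) x *\<^sub>R D)"
      by (intro borel_integrable_compact) auto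
    show "AE x in lborel. norm (s n x) \<le> indicator (cball 0 (r + norm b)) x *\<^sub>R D" for n
      using sb s0 D(1) by (auto simp: indicator_def not_le)
  qed (use lim ms in auto)
  moreover have "(\<integral>x. s n x \<partial>lborel) = 0" for n
  proof -
    have i: "integrable lborel f" using cf 0 by (rule integrable_compact_support)
    have i2: "integrable lborel (\<lambda>x. f (x + (1 / Suc n) *\<^sub>R b))"
    proof (rule integrable_compact_support)
      show "continuous_on UNIV (\<lambda>x. f (x + (1 / Suc n) *\<^sub>R b))"
        by (intro continuous_intros continuous_on_compose2[OF cf]) auto
      show "f (x + (1 / Suc n) *\<^sub>R b) = 0" if "norm x > r + norm b" for x
        using s0[OF that, of n] 0[of x] that norm_ge_zero[of b] by (simp add: s_def)
    qed
    show ?thesis unfolding s_def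
      using integral_lborel_translate[of f "(1 / Suc n) *\<^sub>R b"] i i2 borel_measurable_continuous_onI[OF cf]
      by simp
  qed
  ultimately show ?thesis by (simp add: LIMSEQ_const_iff)
qed

text \<open>The divergence theorem without boundary term: each component contributes 0 by
  itself.\<close>

lemma integral_divergence_0:
  fixes V :: "'a::euclidean_space \<Rightarrow> 'a \<Rightarrow> real"
  assumes V: "\<And>x b. b \<in> Basis \<Longrightarrow> GDERIV (V b) x :> d b x"
    and d: "\<And>b. b \<in> Basis \<Longrightarrow> continuous_on UNIV (d b)"
    and 0: "\<And>x b. b \<in> Basis \<Longrightarrow> norm x > r \<Longrightarrow> V b x = 0"
  shows "(\<integral>x. (\<Sum>b\<in>Basis. d b x \<bullet> b) \<partial>lborel) = 0"
proof -
  have "integrable lborel (\<lambda>x. d b x \<bullet> b)" if b: "b \<in> Basis" for b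
  proof (rule integrable_compact_support)
    show "continuous_on UNIV (\<lambda>x. d b x \<bullet> b)" by (intro continuous_intros d b)
    show "d b x \<bullet> b = 0" if "norm x > r" for x
      using GDERIV_0_outside[OF V[OF b] 0[OF b] that] by simp
  qed
  then have "(\<integral>x. (\<Sum>b\<in>Basis. d b x \<bullet> b) \<partial>lborel) = (\<Sum>b\<in>Basis. \<integral>x. d b x \<bullet> b \<partial>lborel)"
    by (intro Bochner_Integration.integral_sum)
  also have "\<dots> = 0"
    by (intro sum.neutral ballI integral_directional_derivative_0[OF V d 0])
  finally show ?thesis .
qed

subsection \<open>Positivity of the potential\<close>

text \<open>Derivatives are carried as explicit functions so that derivative rules compose directly:
  \<open>q b\<close> is the row of the Hessian of \<open>u\<close> belonging to \<open>b\<close>,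
  and \<open>g\<close>, \<open>g'\<close> are the first two derivatives of \<open>G\<close>.\<close>

locale bounded_solution =
  fixes u :: "'a::euclidean_space \<Rightarrow> real" and p :: "'a \<Rightarrow> 'a" and q :: "'a \<Rightarrow> 'a \<Rightarrow> 'a"
    and G g g' :: "real \<Rightarrow> real" and M :: real
  assumes u: "GDERIV u x :> p x"
    and q: "b \<in> Basis \<Longrightarrow> GDERIV (\<lambda>x. p x \<bullet> b) x :> q b x"
    and cq: "b \<in> Basis \<Longrightarrow> continuous_on UNIV (q b)"
    and eq: "(\<Sum>b\<in>Basis. q b x \<bullet> b) = g (u x)"
    and G: "DERIV G s :> g s" and g: "DERIV g s :> g' s" and cg': "continuous_on UNIV g'"
    and G0: "G s \<ge> 0" and uM: "\<bar>u x\<bar> \<le> M"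
begin

lemma cu: "continuous_on S u" using u by (rule GDERIV_continuous_on)
lemma cg: "continuous_on S g"
  using g by (meson DERIV_continuous_on has_field_derivative_at_within)
lemma cG: "continuous_on S G"
  using G by (meson DERIV_continuous_on has_field_derivative_at_within)

lemma cp: "continuous_on S p"
proof -
  have "continuous_on S (\<lambda>x. \<Sum>b\<in>Basis. (p x \<bullet> b) *\<^sub>R b)"
    by (intro continuous_intros GDERIV_continuous_on[OF q])
  then show ?thesis by (simp add: euclidean_representation)
qed

lemma cgu: "continuous_on S (\<lambda>x. g (u x))" and cg'u: "continuous_on S (\<lambda>x. g' (u x))"
  and cGu: "continuous_on S (\<lambda>x. G (u x))"
  by (rule continuous_on_compose2[OF cg[of UNIV] cu] continuous_on_compose2[OF cg' cu]
      continuous_on_compose2[OF cG[of UNIV] cu]; simp)+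

lemma modica: "(norm (p x))\<^sup>2 \<le> 2 * G (u x)"
  using modica_gradient_bound[OF u q eq G cg G0 uM] .

text \<open>A zero \<open>z\<close> of \<open>G\<close> attained by \<open>u\<close> is a minimum of
  \<open>G\<close>, so \<open>G s\<close> is at most a multiple of \<open>(s - z)^2\<close> on
  \<open>{-M..M}\<close>. Then \<open>modica\<close> bounds the gradient of \<open>u\<close> by a
  multiple of \<open>\<bar>u - z\<bar>\<close>, and a Gronwall argument along segments forces
  \<open>u = z\<close> everywhere.\<close>

lemma potential_pos:
  assumes nc: "\<not> u constant_on UNIV"
  shows "G (u x) > 0"
proof (rule ccontr)
  assume "\<not> G (u x) > 0"
  then have Gz: "G (u x) = 0" using G0[of "u x"] by linarith
  define z where "z = u x"
  have z: "G z = 0" "g z = 0"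
    using Gz DERIV_local_min[OF G[of z], of 1] G0 by (auto simp: z_def)
  obtain C where C: "C \<ge> 0" "\<And>s. s \<in> {-M..M} \<Longrightarrow> \<bar>g' s\<bar> \<le> C"
    using continuous_bounded_on_interval[OF continuous_on_subset[OF cg']] by blast
  have zM: "z \<in> {-M..M}" using uM[of x] unfolding z_def by (auto simp: abs_le_iff)
  have gle: "\<bar>g s\<bar> \<le> C * \<bar>s - z\<bar>" if "s \<in> {-M..M}" for s
  proof -
    have "norm (g s - g z) \<le> C * norm (s - z)"
      by (rule field_differentiable_bound[of "{-M..M}" g g'])
         (use C zM that g in \<open>auto intro: has_field_derivative_at_within\<close>)
    then show ?thesis using z by simp
  qed
  have Gle: "G s \<le> C * (s - z)\<^sup>2" if s: "s \<in> {-M..M}" for s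
  proof -
    have sub: "closed_segment s z \<subseteq> {-M..M}" using s zM by (auto simp: closed_segment_eq_real_ivl)
    have "norm (G s - G z) \<le> (C * \<bar>s - z\<bar>) * norm (s - z)"
    proof (rule field_differentiable_bound[of "closed_segment s z" G g])
      fix t assume t: "t \<in> closed_segment s z"
      then have "\<bar>t - z\<bar> \<le> \<bar>s - z\<bar>" by (auto simp: closed_segment_eq_real_ivl split: if_splits)
      then have "C * \<bar>t - z\<bar> \<le> C * \<bar>s - z\<bar>" using C(1) by (rule mult_left_mono)
      then show "norm (g t) \<le> C * \<bar>s - z\<bar>" using gle[of t] t sub by auto
      show "(G has_field_derivative g t) (at t within closed_segment s z)"
        by (rule has_field_derivative_at_within[OF G])
    qed auto
    then show ?thesis using z G0[of s] by (simp add: power2_eq_square abs_mult_self_eq mult.assoc)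
  qed
  have "u y = z" for y
  proof -
    define h where "h = y - x"
    define f where "f t = (u (x + t *\<^sub>R h) - z)\<^sup>2" for t
    define f' where "f' t = 2 * (u (x + t *\<^sub>R h) - z) * (p (x + t *\<^sub>R h) \<bullet> h)" for t
    define L where "L = 2 * sqrt (2 * C) * norm h"
    have df: "DERIV f t :> f' t" for t
      unfolding f_def f'_def
      by (rule derivative_eq_intros GDERIV_line u refl | simp)+
    have f'le: "f' t \<le> L * f t" for t
    proof -
      define a where "a = u (x + t *\<^sub>R h)"
      have "(norm (p (x + t *\<^sub>R h)))\<^sup>2 \<le> 2 * (C * (a - z)\<^sup>2)"
        using modica[of "x + t *\<^sub>R h"] Gle[of a] uM[of "x + t *\<^sub>R h"] unfolding a_def
        by (auto simp: abs_le_iff)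
      then have "norm (p (x + t *\<^sub>R h)) \<le> sqrt (2 * (C * (a - z)\<^sup>2))"
        by (simp add: real_le_rsqrt)
      also have "\<dots> = sqrt (2 * C) * \<bar>a - z\<bar>" by (simp add: real_sqrt_mult mult.assoc)
      finally have np: "norm (p (x + t *\<^sub>R h)) \<le> sqrt (2 * C) * \<bar>a - z\<bar>" .
      have "f' t \<le> \<bar>f' t\<bar>" by simp
      also have "\<dots> = 2 * \<bar>a - z\<bar> * \<bar>p (x + t *\<^sub>R h) \<bullet> h\<bar>" by (simp only: f'_def a_def[symmetric] abs_mult abs_numeral)
      also have "\<dots> \<le> 2 * \<bar>a - z\<bar> * (norm (p (x + t *\<^sub>R h)) * norm h)"
        by (intro mult_left_mono Cauchy_Schwarz_ineq2) auto
      also have "\<dots> \<le> 2 * \<bar>a - z\<bar> * ((sqrt (2 * C) * \<bar>a - z\<bar>) * norm h)"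
        by (intro mult_left_mono mult_right_mono np) auto
      also have "\<dots> = L * (\<bar>a - z\<bar> * \<bar>a - z\<bar>)" by (simp add: L_def)
      also have "\<dots> = L * f t" unfolding abs_mult_self_eq by (simp add: f_def a_def power2_eq_square)
      finally show ?thesis .
    qed
    \<comment> \<open>The Gronwall step; the right-hand side is 0 because
      \<open>u x = z\<close>.\<close>
    have "f 1 * exp (- L * 1) \<le> f 0 * exp (- L * 0)"
    proof (rule DERIV_nonpos_imp_nonincreasing[of 0 1 "\<lambda>t. f t * exp (- L * t)"])
      fix t :: real
      have "DERIV (\<lambda>t. f t * exp (- L * t)) t :> (f' t - L * f t) * exp (- L * t)"
        by (rule derivative_eq_intros df refl | simp add: algebra_simps)+
      moreover have "(f' t - L * f t) * exp (- L * t) \<le> 0"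
        using f'le[of t] by (intro mult_nonpos_nonneg) auto
      ultimately show "\<exists>y. DERIV (\<lambda>t. f t * exp (- L * t)) t :> y \<and> y \<le> 0" by blast
    qed simp
    then have "f 1 \<le> 0" by (simp add: f_def z_def zero_le_mult_iff mult_le_0_iff)
    then show "u y = z" by (simp add: f_def h_def)
  qed
  then show False using nc by (auto simp: constant_on_def)
qed

end

subsection \<open>Growth of the energy\<close>

text \<open>Its square is the \<open>C1\<close> test function \<eta>, its fourth power the weight
  \<zeta> of the energy. It depends on \<open>x\<close> and \<open>R\<close> only through
  \<open>norm x / R\<close>, which ties the radial derivative to the derivative in
  \<open>R\<close>.\<close>

definition cutoff :: "real \<Rightarrow> 'a::euclidean_space \<Rightarrow> real" where
  "cutoff R x = max 0 (1 - (norm x)\<^sup>2 / R\<^sup>2)"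

lemma cutoff_nonneg: "0 \<le> cutoff R x" and cutoff_le_1: "cutoff R x \<le> 1"
  by (simp_all add: cutoff_def)

lemma cutoff_outside: "R > 0 \<Longrightarrow> norm x \<ge> R \<Longrightarrow> cutoff R x = 0"
  using power_mono[of R "norm x" 2] by (simp add: cutoff_def max_def)

lemma continuous_on_cutoff: "continuous_on S (cutoff R)"
  \<comment> \<open>Division by zero makes \<open>cutoff 0\<close> the constant 1.\<close>
  unfolding cutoff_def by (cases "R = 0") (auto intro!: continuous_intros)

text \<open>Squaring removes the kink of the positive part at 0; this is why only even powers of
  \<open>cutoff\<close> are differentiated.\<close>

lemma DERIV_pos_part_square: "DERIV (\<lambda>t::real. (max 0 t)\<^sup>2) t :> 2 * max 0 t"
proof -
  consider "t < 0" | "t > 0" | "t = 0" by linarith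
  then show ?thesis
  proof cases
    case 1
    show ?thesis
      by (rule has_field_derivative_transform_within_open[of "\<lambda>_. 0" _ _ "{..<0}"])
         (use 1 in \<open>auto simp: max_def\<close>)
  next
    case 2
    show ?thesis
      by (rule has_field_derivative_transform_within_open[of "\<lambda>t. t\<^sup>2" _ _ "{0<..}"])
         (use 2 in \<open>auto intro!: derivative_eq_intros simp: max_def\<close>)
  next
    case 3
    have "((\<lambda>h::real. (max 0 h)\<^sup>2 / h) \<longlongrightarrow> 0) (at 0)"
    proof (rule tendsto_rabs_zero_cancel, rule tendsto_sandwich[of "\<lambda>_. 0" _ _ "\<lambda>h. \<bar>h\<bar>"])
      show "((\<lambda>h::real. \<bar>h\<bar>) \<longlongrightarrow> 0) (at 0)" by (intro tendsto_eq_intros) auto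
    qed (auto simp: max_def power2_eq_square intro!: always_eventually)
    then show ?thesis using 3 by (simp add: DERIV_def)
  qed
qed

lemma GDERIV_cutoff_square:
  "GDERIV (\<lambda>x. (cutoff R x)\<^sup>2) x :> (- 4 * cutoff R x / R\<^sup>2) *\<^sub>R x"
proof -
  have "GDERIV (\<lambda>x. 1 - (1 / R\<^sup>2) * (norm x)\<^sup>2) x :> 0 - ((1 / R\<^sup>2) *\<^sub>R (2 *\<^sub>R x) + (norm x)\<^sup>2 *\<^sub>R 0)"
    by (intro GDERIV_diff GDERIV_mult GDERIV_const GDERIV_norm_power2)
  then have "GDERIV (\<lambda>x. 1 - (norm x)\<^sup>2 / R\<^sup>2) x :> (- 2 / R\<^sup>2) *\<^sub>R x" by simp
  from GDERIV_DERIV_compose[OF this DERIV_pos_part_square] show ?thesis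
    by (simp add: cutoff_def)
qed

lemma GDERIV_cutoff_power4:
  "GDERIV (\<lambda>x. (cutoff R x)^4) x :> (- (8 * (cutoff R x)^3 / R\<^sup>2)) *\<^sub>R x"
proof -
  have "GDERIV (\<lambda>x. (cutoff R x)\<^sup>2 * (cutoff R x)\<^sup>2) x :>
      (cutoff R x)\<^sup>2 *\<^sub>R ((- 4 * cutoff R x / R\<^sup>2) *\<^sub>R x)
      + (cutoff R x)\<^sup>2 *\<^sub>R ((- 4 * cutoff R x / R\<^sup>2) *\<^sub>R x)"
    by (intro GDERIV_mult GDERIV_cutoff_square)
  moreover have "(\<lambda>x. (cutoff R x)\<^sup>2 * (cutoff R x)\<^sup>2) = (\<lambda>x. (cutoff R x)^4)"
    by (simp add: fun_eq_iff power_add[symmetric])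
  moreover have "(cutoff R x)\<^sup>2 *\<^sub>R ((- 4 * cutoff R x / R\<^sup>2) *\<^sub>R x)
      + (cutoff R x)\<^sup>2 *\<^sub>R ((- 4 * cutoff R x / R\<^sup>2) *\<^sub>R x) = (- (8 * (cutoff R x)^3 / R\<^sup>2)) *\<^sub>R x"
    by (simp only: scaleR_scaleR scaleR_add_left[symmetric]) (simp add: power2_eq_square power3_eq_cube)
  ultimately show ?thesis by simp
qed

text \<open>\<open>R\<close> times this derivative is minus the radial derivative of the weight,
  that is, minus the inner product of \<open>x\<close> with the gradient in
  \<open>GDERIV_cutoff_power4\<close>. So a term of the Pohozaev identity becomes a derivative in
  \<open>R\<close>.\<close>

lemma DERIV_cutoff_radius:
  assumes "R > 0"
  shows "DERIV (\<lambda>R. (cutoff R x)^4) R :> 8 * (cutoff R x)^3 * (norm x)\<^sup>2 / R^3"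
proof -
  have 1: "DERIV (\<lambda>R. 1 - (norm x)\<^sup>2 / R\<^sup>2) R :> 2 * (norm x)\<^sup>2 / R^3"
    using assms by (auto intro!: derivative_eq_intros simp: field_simps power2_eq_square power3_eq_cube)
  have "DERIV (\<lambda>R. (cutoff R x)\<^sup>2) R :> (2 * cutoff R x) * (2 * (norm x)\<^sup>2 / R^3)"
    unfolding cutoff_def by (rule DERIV_chain2[OF DERIV_pos_part_square 1])
  from DERIV_power[OF this, of 2] have "DERIV (\<lambda>R. ((cutoff R x)\<^sup>2)\<^sup>2) R :> 8 * (cutoff R x)^3 * (norm x)\<^sup>2 / R^3"
    by (simp add: power2_eq_square power3_eq_cube mult_ac)
  then show ?thesis by (simp flip: power_mult)
qed

text \<open>Passes to the gauge integral over a box, where the Leibniz rule for parameter integrals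
  is applied.\<close>

lemma integral_lborel_cbox:
  fixes f :: "'a::euclidean_space \<Rightarrow> real"
  assumes f: "continuous_on UNIV f" and 0: "\<And>x. x \<notin> cbox a b \<Longrightarrow> f x = 0"
  shows "(\<integral>x. f x \<partial>lborel) = integral (cbox a b) f"
proof -
  obtain r where r: "\<And>x. x \<in> cbox a b \<Longrightarrow> norm x \<le> r"
    using bounded_cbox bounded_iff by metis
  have "integrable lborel f"
    using r by (intro integrable_compact_support[OF f, of r] 0) (auto simp: not_le[symmetric])
  from integral_lborel[OF this] have "(\<integral>x. f x \<partial>lborel) = integral UNIV f" by simp
  moreover have "(\<lambda>x. if x \<in> cbox a b then f x else 0) = f" using 0 by auto
  ultimately show ?thesis using integral_restrict_UNIV[of "cbox a b" f] by simp
qed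

section \<open>Pohozaev identity and monotonicity of the weighted energy\<close>

context bounded_solution
begin

definition energy_density :: "'a \<Rightarrow> real" where
  "energy_density x = (norm (p x))\<^sup>2 / 2 + G (u x)"

lemma energy_density_nonneg: "0 \<le> energy_density x"
  by (simp add: energy_density_def G0)

lemma continuous_energy_density: "continuous_on S energy_density"
  unfolding energy_density_def by (intro continuous_intros cp cGu) auto

text \<open>Schwarz's theorem for each pair of basis vectors, extended bilinearly. It cancels the
  second-order terms in \<open>pohozaev\<close>.\<close>

lemma hessian_symmetric:
  "(\<Sum>c\<in>Basis. (y \<bullet> c) * (q c x \<bullet> z)) = (\<Sum>c\<in>Basis. (z \<bullet> c) * (q c x \<bullet> y))"
proof -
  have "(\<Sum>c\<in>Basis. (y \<bullet> c) * (q c x \<bullet> z)) = (\<Sum>c\<in>Basis. \<Sum>b\<in>Basis. (y \<bullet> c) * ((q c x \<bullet> b) * (z \<bullet> b)))"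
    by (subst euclidean_inner) (simp add: sum_distrib_left)
  also have "\<dots> = (\<Sum>b\<in>Basis. \<Sum>c\<in>Basis. (y \<bullet> c) * ((q c x \<bullet> b) * (z \<bullet> b)))"
    by (rule sum.swap)
  also have "\<dots> = (\<Sum>b\<in>Basis. \<Sum>c\<in>Basis. (z \<bullet> b) * ((q b x \<bullet> c) * (y \<bullet> c)))"
    by (intro sum.cong refl)
       (simp add: second_partials_symmetric[OF u q cq q cq])
  also have "\<dots> = (\<Sum>c\<in>Basis. (z \<bullet> c) * (q c x \<bullet> y))"
    by (subst (2) euclidean_inner) (simp add: sum_distrib_left)
  finally show ?thesis .
qed

text \<open>The vector field is the stress-energy tensor contracted with the dilation field \<open>x\<close>.\<close>

lemma pohozaev:
  assumes \<zeta>: "\<And>x. GDERIV \<zeta> x :> z x" and cz: "continuous_on UNIV z"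
    and 0: "\<And>x. norm x > r \<Longrightarrow> \<zeta> x = 0"
  shows "(\<integral>x. \<zeta> x * ((norm (p x))\<^sup>2 - DIM('a) * energy_density x)
      + (x \<bullet> p x) * (p x \<bullet> z x) - energy_density x * (x \<bullet> z x) \<partial>lborel) = 0"
proof -
  define dX where "dX x = (\<Sum>c\<in>Basis. (x \<bullet> c) *\<^sub>R q c x + (p x \<bullet> c) *\<^sub>R c)" for x
  define de where "de x = (\<Sum>c\<in>Basis. (p x \<bullet> c) *\<^sub>R q c x) + g (u x) *\<^sub>R p x" for x
  have coord: "GDERIV (\<lambda>x. x \<bullet> c) x :> c" for c x :: 'a
    unfolding gderiv_def by (auto intro!: derivative_eq_intros)
  have X: "GDERIV (\<lambda>x. x \<bullet> p x) x :> dX x" for x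
    unfolding dX_def by (subst euclidean_inner) (intro GDERIV_sum GDERIV_mult q coord; simp)
  have e: "GDERIV energy_density x :> de x" for x
  proof -
    have "GDERIV (\<lambda>x. \<Sum>c\<in>Basis. (p x \<bullet> c) * (p x \<bullet> c)) x :>
        (\<Sum>c\<in>Basis. (p x \<bullet> c) *\<^sub>R q c x + (p x \<bullet> c) *\<^sub>R q c x)"
      by (intro GDERIV_sum GDERIV_mult q; simp)
    then have "GDERIV (\<lambda>x. (1/2) * (\<Sum>c\<in>Basis. (p x \<bullet> c) * (p x \<bullet> c)) + G (u x)) x :>
        ((1/2) *\<^sub>R (\<Sum>c\<in>Basis. (p x \<bullet> c) *\<^sub>R q c x + (p x \<bullet> c) *\<^sub>R q c x)
          + (\<Sum>c\<in>Basis. (p x \<bullet> c) * (p x \<bullet> c)) *\<^sub>R 0) + g (u x) *\<^sub>R p x"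
      by (intro GDERIV_add GDERIV_mult GDERIV_const GDERIV_DERIV_compose[OF u G])
    moreover have "(\<lambda>x. (1/2) * (\<Sum>c\<in>Basis. (p x \<bullet> c) * (p x \<bullet> c)) + G (u x)) = energy_density"
      by (simp add: fun_eq_iff energy_density_def power2_norm_eq_inner euclidean_inner[symmetric])
    ultimately show ?thesis by (simp add: de_def sum.distrib scaleR_2[symmetric] scaleR_sum_right)
  qed
  define V where "V b x = ((x \<bullet> p x) * (p x \<bullet> b) - energy_density x * (x \<bullet> b)) * \<zeta> x" for b x
  define d where "d b x = ((x \<bullet> p x) * (p x \<bullet> b) - energy_density x * (x \<bullet> b)) *\<^sub>R z x
    + \<zeta> x *\<^sub>R (((x \<bullet> p x) *\<^sub>R q b x + (p x \<bullet> b) *\<^sub>R dX x)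
       - (energy_density x *\<^sub>R b + (x \<bullet> b) *\<^sub>R de x))" for b x
  have "(\<integral>x. (\<Sum>b\<in>Basis. d b x \<bullet> b) \<partial>lborel) = 0"
  proof (rule integral_divergence_0)
    show "GDERIV (V b) x :> d b x" if "b \<in> Basis" for b x
      unfolding V_def d_def by (intro GDERIV_mult GDERIV_diff X e \<zeta> coord q that)
    show "continuous_on UNIV (d b)" if "b \<in> Basis" for b
      unfolding d_def dX_def de_def
      by (intro continuous_intros cp cz continuous_energy_density GDERIV_continuous_on[OF \<zeta>] cq that cgu)
    show "V b x = 0" if "norm x > r" for b x by (simp add: V_def 0 that)
  qed
  moreover have "(\<Sum>b\<in>Basis. d b x \<bullet> b) = \<zeta> x * ((norm (p x))\<^sup>2 - DIM('a) * energy_density x)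
      + (x \<bullet> p x) * (p x \<bullet> z x) - energy_density x * (x \<bullet> z x)" for x
  proof -
    have "(\<Sum>b\<in>Basis. d b x \<bullet> b) =
        (x \<bullet> p x) * (\<Sum>b\<in>Basis. (p x \<bullet> b) * (z x \<bullet> b)) - energy_density x * (\<Sum>b\<in>Basis. (x \<bullet> b) * (z x \<bullet> b))
        + \<zeta> x * (((x \<bullet> p x) * (\<Sum>b\<in>Basis. q b x \<bullet> b) + (\<Sum>b\<in>Basis. (p x \<bullet> b) * (dX x \<bullet> b)))
          - (energy_density x * (\<Sum>b\<in>(Basis::'a set). b \<bullet> b) + (\<Sum>b\<in>Basis. (x \<bullet> b) * (de x \<bullet> b))))"
      unfolding d_def
      by (simp add: inner_add_left inner_diff_left sum.distrib sum_subtractf sum_distrib_left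
          algebra_simps)
    also have "\<dots> = (x \<bullet> p x) * (p x \<bullet> z x) - energy_density x * (x \<bullet> z x)
        + \<zeta> x * (((x \<bullet> p x) * g (u x) + p x \<bullet> dX x) - (energy_density x * DIM('a) + x \<bullet> de x))"
      unfolding euclidean_inner[symmetric] eq by simp
    also have "p x \<bullet> dX x = (\<Sum>c\<in>Basis. (x \<bullet> c) * (q c x \<bullet> p x)) + (norm (p x))\<^sup>2"
      by (simp add: dX_def inner_sum_right inner_add_right sum.distrib power2_norm_eq_inner
          euclidean_inner[of "p x" "p x"] inner_commute[of _ "q _ x"])
    also have "x \<bullet> de x = (\<Sum>c\<in>Basis. (p x \<bullet> c) * (q c x \<bullet> x)) + g (u x) * (x \<bullet> p x)"
      by (simp add: de_def inner_sum_right inner_add_right inner_commute[of _ "q _ x"])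
    \<comment> \<open>The Hessian terms of \<open>dX\<close> and \<open>de\<close> cancel, and so do
      the two terms \<open>g (u x) * (x \<bullet> p x)\<close>, one from the Laplacian and one from
      \<open>de\<close>.\<close>
    also have "(\<Sum>c\<in>Basis. (x \<bullet> c) * (q c x \<bullet> p x)) = (\<Sum>c\<in>Basis. (p x \<bullet> c) * (q c x \<bullet> x))"
      by (rule hessian_symmetric)
    finally show ?thesis by (simp add: algebra_simps)
  qed
  ultimately show ?thesis by simp
qed

definition weighted_energy :: "real \<Rightarrow> real" where
  "weighted_energy R = (\<integral>x. (cutoff R x)^4 * energy_density x \<partial>lborel)"

text \<open>\<open>pohozaev\<close> with weight \<open>(cutoff R x)^4\<close>: Modica's bound gives
  \<open>(norm (p x))^2 \<le> energy_density x\<close>, which leaves the factor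
  \<open>DIM('a) - 1\<close>, and the term quadratic in \<open>x \<bullet> p x\<close> is
  nonpositive because the weight decreases radially. The right-hand side is \<open>R\<close> times
  the derivative of \<open>weighted_energy\<close>.\<close>

lemma weighted_energy_le:
  assumes R: "R > 0"
  shows "(real DIM('a) - 1) * weighted_energy R
    \<le> (\<integral>x. 8 * (cutoff R x)^3 * (norm x)\<^sup>2 / R\<^sup>2 * energy_density x \<partial>lborel)"
proof -
  let ?z = "\<lambda>x::'a. (- (8 * (cutoff R x)^3 / R\<^sup>2)) *\<^sub>R x"
  let ?P = "\<lambda>x. (cutoff R x)^4 * ((norm (p x))\<^sup>2 - DIM('a) * energy_density x)
      + (x \<bullet> p x) * (p x \<bullet> ?z x) - energy_density x * (x \<bullet> ?z x)"
  let ?E = "\<lambda>x. (cutoff R x)^4 * energy_density x"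
  let ?J = "\<lambda>x. 8 * (cutoff R x)^3 * (norm x)\<^sup>2 / R\<^sup>2 * energy_density x"
  note [continuous_intros] = continuous_on_cutoff cp continuous_energy_density
  have i: "integrable lborel ?P" "integrable lborel ?E" "integrable lborel ?J"
    using R by (auto intro!: integrable_compact_support[of _ R] continuous_intros simp: cutoff_outside)
  have "(\<integral>x. ?P x \<partial>lborel) = 0"
    using R by (intro pohozaev[of _ _ R] GDERIV_cutoff_power4 continuous_intros) (auto simp: cutoff_outside)
  moreover have "(\<integral>x. ?P x \<partial>lborel) \<le> (\<integral>x. ?J x - (real DIM('a) - 1) * ?E x \<partial>lborel)"
  proof (rule integral_mono)
    fix x
    have "(norm (p x))\<^sup>2 \<le> energy_density x" using modica[of x] by (simp add: energy_density_def)
    then have "(cutoff R x)^4 * ((norm (p x))\<^sup>2 - DIM('a) * energy_density x)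
        \<le> (cutoff R x)^4 * (energy_density x - DIM('a) * energy_density x)"
      by (intro mult_left_mono) auto
    also have "\<dots> = - ((real DIM('a) - 1) * ?E x)" by (simp add: algebra_simps)
    finally have "(cutoff R x)^4 * ((norm (p x))\<^sup>2 - DIM('a) * energy_density x)
        \<le> - ((real DIM('a) - 1) * ?E x)" .
    moreover have "(x \<bullet> p x) * (p x \<bullet> ?z x) \<le> 0"
    proof -
      have "(x \<bullet> p x) * (p x \<bullet> ?z x) = - ((8 * (cutoff R x)^3 / R\<^sup>2) * (x \<bullet> p x)\<^sup>2)"
        by (simp add: inner_commute[of "p x"] power2_eq_square)
      also have "\<dots> \<le> 0" using cutoff_nonneg[of R x] by simp
      finally show ?thesis .
    qed
    moreover have "- (energy_density x * (x \<bullet> ?z x)) = ?J x"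
      by (simp add: power2_norm_eq_inner)
    ultimately show "?P x \<le> ?J x - (real DIM('a) - 1) * ?E x"
      by linarith
  qed (use i in auto)
  ultimately show ?thesis using i by (simp add: weighted_energy_def)
qed

text \<open>Differentiation under the integral sign, on one fixed box that contains the supports for
  all radii in \<open>{R/2..2 * R}\<close>.\<close>

lemma DERIV_weighted_energy:
  assumes R: "R > 0"
  shows "DERIV weighted_energy R
    :> (\<integral>x. 8 * (cutoff R x)^3 * (norm x)\<^sup>2 / R\<^sup>2 * energy_density x \<partial>lborel) / R"
proof -
  note [continuous_intros] = continuous_on_cutoff cp continuous_energy_density
  define b where "b = 2 * R"
  obtain c :: 'a where c: "cball 0 b \<subseteq> cbox (- c) c"
    by (meson bounded_cball bounded_subset_cbox_symmetric)
  have 0: "cutoff S x = 0" if "x \<notin> cbox (- c) c" "S \<in> {R/2..b}" for S and x :: 'a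
    using that c R by (intro cutoff_outside) (auto simp: subset_eq)
  have W: "weighted_energy S = integral (cbox (- c) c) (\<lambda>x. (cutoff S x)^4 * energy_density x)"
    if "S \<in> {R/2..b}" for S
    unfolding weighted_energy_def using that
    by (intro integral_lborel_cbox continuous_intros) (auto simp: 0)
  let ?D = "\<lambda>S x. 8 * (cutoff S x)^3 * (norm x)\<^sup>2 / S^3 * energy_density x"
  have RU: "R \<in> {R/2..b}" using R by (simp add: b_def)
  have "((\<lambda>S. integral (cbox (- c) c) (\<lambda>x. (cutoff S x)^4 * energy_density x))
      has_field_derivative integral (cbox (- c) c) (?D R)) (at R within {R/2..b})"
  proof (rule leibniz_rule_field_derivative)
    show "((\<lambda>S. (cutoff S x)^4 * energy_density x) has_field_derivative ?D S x) (at S within {R/2..b})"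
      if "S \<in> {R/2..b}" for S x
      using that R by (intro has_field_derivative_at_within[OF DERIV_cmult_right] DERIV_cutoff_radius) auto
    show "(\<lambda>x. (cutoff S x)^4 * energy_density x) integrable_on cbox (- c) c" for S
      by (intro integrable_continuous continuous_intros)
    show "continuous_on ({R/2..b} \<times> cbox (- c) c) (\<lambda>(S, x). ?D S x)"
      unfolding split_beta cutoff_def using R
      by (intro continuous_intros continuous_on_compose2[OF continuous_energy_density[of UNIV]]) auto
  qed (use RU in auto)
  then have "(weighted_energy has_field_derivative integral (cbox (- c) c) (?D R)) (at R within {R/2..b})"
    by (rule has_field_derivative_transform_within[where d = 1]) (use RU W in auto)
  then have "DERIV weighted_energy R :> integral (cbox (- c) c) (?D R)"
    using R by (simp add: at_within_Icc_at b_def)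
  also have "integral (cbox (- c) c) (?D R) = (\<integral>x. ?D R x \<partial>lborel)"
    using RU R by (intro integral_lborel_cbox[symmetric] continuous_intros) (auto simp: 0)
  also have "\<dots> = (\<integral>x. 8 * (cutoff R x)^3 * (norm x)\<^sup>2 / R\<^sup>2 * energy_density x / R \<partial>lborel)"
    by (simp add: power2_eq_square power3_eq_cube)
  finally show ?thesis by simp
qed

text \<open>With \<open>W = weighted_energy\<close> the two preceding lemmas say
  \<open>(DIM('a) - 1) * W \<le> R * W'\<close>, which is the sign of the derivative of the
  quotient.\<close>

lemma weighted_energy_monotone:
  assumes "0 < R" "R \<le> S"
  shows "weighted_energy R / R ^ (DIM('a) - 1) \<le> weighted_energy S / S ^ (DIM('a) - 1)"
proof (rule DERIV_nonneg_imp_nondecreasing[OF assms(2),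
      of "\<lambda>t. weighted_energy t / t ^ (DIM('a) - 1)"])
  fix t assume "R \<le> t" then have t: "t > 0" using assms(1) by simp
  define n where "n = DIM('a) - 1"
  define J where "J = (\<integral>x. 8 * (cutoff t x)^3 * (norm x)\<^sup>2 / t\<^sup>2 * energy_density x \<partial>lborel)"
  have n: "real n = real DIM('a) - 1" by (simp add: n_def of_nat_diff Suc_le_eq)
  have "DERIV (\<lambda>t. weighted_energy t / t ^ n) t :>
      ((J / t) * t ^ n - weighted_energy t * (real n * t ^ (n - 1))) / (t ^ n * t ^ n)"
    using t DERIV_weighted_energy[OF t]
    by (intro DERIV_divide) (auto simp: J_def intro!: derivative_eq_intros)
  moreover have "weighted_energy t * (real n * t ^ (n - 1)) \<le> (J / t) * t ^ n"
  proof -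
    have J: "real n * weighted_energy t \<le> J" unfolding n J_def by (rule weighted_energy_le[OF t])
    \<comment> \<open>For \<open>n = 0\<close> the truncated exponent \<open>n - 1\<close> does no
      harm, since the factor \<open>real n\<close> vanishes.\<close>
    have "real n * t ^ (n - 1) = real n * t ^ n / t" using t by (cases n) auto
    then have "weighted_energy t * (real n * t ^ (n - 1)) = (real n * weighted_energy t) * (t ^ n / t)" by simp
    also have "\<dots> \<le> J * (t ^ n / t)" using J t by (intro mult_right_mono) auto
    finally show ?thesis by simp
  qed
  ultimately show "\<exists>y. DERIV (\<lambda>t. weighted_energy t / t ^ (DIM('a) - 1)) t :> y \<and> 0 \<le> y"
    unfolding n_def[symmetric] using t by (intro exI conjI) (auto intro!: divide_nonneg_nonneg)
qed

text \<open>By monotonicity it is enough that the energy at radius 1 is positive; that value serves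
  as \<open>c\<close>.\<close>

lemma weighted_energy_growth:
  assumes nc: "\<not> u constant_on UNIV"
  obtains c where "c > 0" "\<And>R. R \<ge> 1 \<Longrightarrow> c * R ^ (DIM('a) - 1) \<le> weighted_energy R"
proof
  note [continuous_intros] = continuous_on_cutoff continuous_energy_density
  let ?f = "\<lambda>x. (cutoff 1 x)^4 * energy_density x"
  have cf: "continuous_on S ?f" for S by (intro continuous_intros)
  \<comment> \<open>On the ball of radius 1/2, \<open>cutoff 1\<close> is at least 3/4, so the
    minimum of the weighted density there is positive.\<close>
  obtain y where y: "y \<in> cball (0::'a) (1/2)" "\<And>x. x \<in> cball 0 (1/2) \<Longrightarrow> ?f y \<le> ?f x"
    using continuous_attains_inf[OF compact_cball _ cf, of "0::'a" "1/2"] by auto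
  have "cutoff 1 y > 0" using y(1) power_mono[of "norm y" "1/2" 2]
    by (simp add: cutoff_def power2_eq_square)
  moreover have "energy_density y > 0"
    using potential_pos[OF nc, of y] by (simp add: energy_density_def add_nonneg_pos)
  ultimately have fy: "?f y > 0" by simp
  have "?f y * measure lborel (cball (0::'a) (1/2)) = (\<integral>x. indicator (cball (0::'a) (1/2)) x *\<^sub>R ?f y \<partial>lborel)"
    using emeasure_lborel_cball_finite[of "0::'a" "1/2"] by simp
  also have "\<dots> \<le> (\<integral>x. ?f x \<partial>lborel)"
  proof (rule integral_mono)
    show "integrable lborel (\<lambda>x. indicator (cball (0::'a) (1/2)) x *\<^sub>R ?f y)"
      by (intro borel_integrable_compact) auto
    show "integrable lborel ?f"
      using cf by (rule integrable_compact_support[of _ 1]) (simp add: cutoff_outside)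
    show "indicator (cball 0 (1/2)) x *\<^sub>R ?f y \<le> ?f x" for x
      using y(2)[of x] energy_density_nonneg[of x] by (auto simp: indicator_def)
  qed
  finally show "weighted_energy 1 > 0"
    using fy content_cball_pos[of "1/2" "0::'a"] unfolding weighted_energy_def
    by (smt (verit) mult_pos_pos half_gt_zero zero_less_one)
  show "weighted_energy 1 * R ^ (DIM('a) - 1) \<le> weighted_energy R" if "R \<ge> 1" for R
    using weighted_energy_monotone[of 1 R] that by (simp add: field_simps)
qed

end

subsection \<open>Stability and the Dirichlet energy\<close>

text \<open>Otherwise the second-order Taylor bound would make \<open>G\<close> negative at \<open>s - g s / C\<close>.\<close>

lemma nonneg_derivative_square_le:
  fixes G g g' :: "real \<Rightarrow> real"
  assumes G: "\<And>s. DERIV G s :> g s" and g: "\<And>s. DERIV g s :> g' s"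
    and cg': "continuous_on UNIV g'" and G0: "\<And>s. G s \<ge> 0"
  obtains C where "C > 0" "\<And>s. \<bar>s\<bar> \<le> M \<Longrightarrow> \<bar>g' s\<bar> \<le> C" "\<And>s. \<bar>s\<bar> \<le> M \<Longrightarrow> (g s)\<^sup>2 \<le> 2 * C * G s"
proof -
  have cg: "continuous_on S g" for S
    using g by (meson DERIV_continuous_on has_field_derivative_at_within)
  \<comment> \<open>The interval is enlarged by 1 because the comparison point \<open>s + t\<close>
    below may leave \<open>{-M..M}\<close>; \<open>C2 \<le> C\<close> ensures
    \<open>\<bar>t\<bar> \<le> 1\<close>.\<close>
  obtain C1 where C1: "C1 \<ge> 0" "\<And>s. s \<in> {-M-1..M+1} \<Longrightarrow> \<bar>g' s\<bar> \<le> C1"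
    using continuous_bounded_on_interval[OF continuous_on_subset[OF cg']] by blast
  obtain C2 where C2: "C2 \<ge> 0" "\<And>s. s \<in> {-M-1..M+1} \<Longrightarrow> \<bar>g s\<bar> \<le> C2"
    using continuous_bounded_on_interval[OF cg] by blast
  define C where "C = C1 + C2 + 1"
  have C: "C > 0" "C1 \<le> C" "C2 \<le> C" using C1 C2 by (auto simp: C_def)
  show ?thesis
  proof
    show "C > 0" by fact
    show "\<bar>g' s\<bar> \<le> C" if "\<bar>s\<bar> \<le> M" for s
      using C1(2)[of s] C(2) that by (auto simp: abs_le_iff)
    show "(g s)\<^sup>2 \<le> 2 * C * G s" if s: "\<bar>s\<bar> \<le> M" for s
    proof -
      define t where "t = - g s / C"
      have sI: "s \<in> {-M-1..M+1}" using s by (auto simp: abs_le_iff)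
      have "\<bar>t\<bar> \<le> 1" using C2(2)[OF sI] C by (simp add: t_def)
      then have tI: "s + t \<in> {-M-1..M+1}" using s by (auto simp: abs_le_iff)
      \<comment> \<open>Tangent inequality at \<open>s\<close> for
        \<open>C / 2 * (r - s)^2 - G r\<close>, which is convex on the interval because
        \<open>g' \<le> C\<close>.\<close>
      have "(C * (s - s) - g s) * (s + t - s) \<le> (C / 2 * (s + t - s)\<^sup>2 - G (s + t)) - (C / 2 * (s - s)\<^sup>2 - G s)"
      proof (rule f''_imp_f'[of "{-M-1..M+1}" "\<lambda>r. C / 2 * (r - s)\<^sup>2 - G r" "\<lambda>r. C * (r - s) - g r" "\<lambda>r. C - g' r"])
        show "DERIV (\<lambda>r. C / 2 * (r - s)\<^sup>2 - G r) r :> C * (r - s) - g r" for r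
          by (auto intro!: derivative_eq_intros G)
        show "DERIV (\<lambda>r. C * (r - s) - g r) r :> C - g' r" for r
          by (auto intro!: derivative_eq_intros g)
        show "0 \<le> C - g' r" if "r \<in> {-M-1..M+1}" for r
          using C1(2)[OF that] C(2) by linarith
      qed (use sI tI in auto)
      then have "- g s * t \<le> C / 2 * t\<^sup>2 + G s" using G0[of "s + t"] by simp
      then have "(g s)\<^sup>2 / C \<le> (g s)\<^sup>2 / (2 * C) + G s"
        using C(1) by (simp add: t_def power2_eq_square)
      then show ?thesis using C(1) by (simp add: field_simps)
    qed
  qed
qed

text \<open>The third identity computes \<open>\<phi>'' * \<phi>\<close> for
  \<open>\<phi> = sqrt G\<close>. Its negative is the coefficient in
  \<open>stability_identity\<close>; this is how the concavity hypothesis enters.\<close>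

lemma DERIV_sqrt_twice:
  assumes G: "\<And>s. DERIV G s :> g s" and g: "\<And>s. DERIV g s :> g' s" and pos: "G s > 0"
  shows "DERIV (\<lambda>t. sqrt (G t)) s :> g s / (2 * sqrt (G s))"
    and "DERIV (\<lambda>t. g t / (2 * sqrt (G t))) s :> deriv (deriv (\<lambda>t. sqrt (G t))) s"
    and "deriv (deriv (\<lambda>t. sqrt (G t))) s * sqrt (G s) = g' s / 2 - (g s)\<^sup>2 / (4 * G s)"
proof -
  have d: "DERIV (\<lambda>t. sqrt (G t)) t :> g t / (2 * sqrt (G t))" if "G t > 0" for t
    using DERIV_chain2[OF DERIV_real_sqrt[OF that] G] by (simp add: field_simps)
  then show "DERIV (\<lambda>t. sqrt (G t)) s :> g s / (2 * sqrt (G s))" using pos .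
  define D where "D = (g' s * (2 * sqrt (G s)) - g s * (2 * (g s / (2 * sqrt (G s)))))
    / ((2 * sqrt (G s)) * (2 * sqrt (G s)))"
  have D: "DERIV (\<lambda>t. g t / (2 * sqrt (G t))) s :> D"
    unfolding D_def using pos by (intro DERIV_divide g DERIV_cmult d) auto
  \<comment> \<open>The formula for the first derivative holds where \<open>G > 0\<close>; this set
    is open, so the formula may be differentiated at \<open>s\<close>.\<close>
  have "continuous_on UNIV G" using G by (meson DERIV_continuous_on has_field_derivative_at_within)
  then have op: "open {t. 0 < G t}" by (intro open_Collect_less) auto
  have "DERIV (deriv (\<lambda>t. sqrt (G t))) s :> D"
    by (rule has_field_derivative_transform_within_open[OF D op])
       (use pos DERIV_imp_deriv[OF d] in auto)
  then have eq: "deriv (deriv (\<lambda>t. sqrt (G t))) s = D" by (rule DERIV_imp_deriv)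
  show "DERIV (\<lambda>t. g t / (2 * sqrt (G t))) s :> deriv (deriv (\<lambda>t. sqrt (G t))) s"
    using D unfolding eq .
  define w where "w = sqrt (G s)"
  have w: "w > 0" "G s = w * w" using pos by (auto simp: w_def)
  show "deriv (deriv (\<lambda>t. sqrt (G t))) s * sqrt (G s) = g' s / 2 - (g s)\<^sup>2 / (4 * G s)"
    unfolding eq D_def w_def[symmetric] w(2) using w(1)
    by (simp add: field_simps power2_eq_square)
qed

text \<open>Strict concavity of \<open>\<phi>\<close>: since \<open>\<phi> \<ge> 0\<close> at a point of the interval at distance at least
  \<open>(b - a) / 2\<close>, the value and the slope of \<open>\<phi>\<close> cannot both be small.\<close>

lemma concave_value_or_slope:
  fixes \<phi> \<phi>' \<phi>'' :: "real \<Rightarrow> real"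
  assumes J: "convex J" and d: "\<And>s. s \<in> J \<Longrightarrow> DERIV \<phi> s :> \<phi>' s"
    and d2: "\<And>s. s \<in> J \<Longrightarrow> DERIV \<phi>' s :> \<phi>'' s" and K: "\<And>s. s \<in> J \<Longrightarrow> \<phi>'' s \<le> - K" "K > 0"
    and pos: "\<And>s. s \<in> J \<Longrightarrow> 0 \<le> \<phi> s" and JM: "\<And>s. s \<in> J \<Longrightarrow> \<bar>s\<bar> \<le> M"
    and ab: "a \<in> J" "b \<in> J" "a < b" and s: "s \<in> J"
  shows "K * (b - a)\<^sup>2 / 8 \<le> \<phi> s + 2 * M * \<bar>\<phi>' s\<bar>"
proof -
  obtain t where t: "t \<in> J" "(b - a) / 2 \<le> \<bar>t - s\<bar>"
  proof (cases "s \<le> (a + b) / 2")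
    case True then show ?thesis using ab that[of b] by (auto simp: field_simps abs_if)
  next
    case False then show ?thesis using ab that[of a] by (auto simp: field_simps abs_if)
  qed
  \<comment> \<open>Tangent inequality at \<open>s\<close> for the convex function
    \<open>- \<phi> r - K / 2 * (r - s)^2\<close>.\<close>
  have "(- \<phi>' s - K * (s - s)) * (t - s)
      \<le> (- \<phi> t - K / 2 * (t - s)\<^sup>2) - (- \<phi> s - K / 2 * (s - s)\<^sup>2)"
  proof (rule f''_imp_f'[OF J, of "\<lambda>r. - \<phi> r - K / 2 * (r - s)\<^sup>2" "\<lambda>r. - \<phi>' r - K * (r - s)"
        "\<lambda>r. - \<phi>'' r - K"])
    show "DERIV (\<lambda>r. - \<phi> r - K / 2 * (r - s)\<^sup>2) r :> - \<phi>' r - K * (r - s)" if "r \<in> J" for r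
      using d[OF that] by (auto intro!: derivative_eq_intros)
    show "DERIV (\<lambda>r. - \<phi>' r - K * (r - s)) r :> - \<phi>'' r - K" if "r \<in> J" for r
      using d2[OF that] by (auto intro!: derivative_eq_intros)
    show "0 \<le> - \<phi>'' r - K" if "r \<in> J" for r using K(1)[OF that] by simp
  qed (use s t in auto)
  then have 1: "K / 2 * (t - s)\<^sup>2 \<le> \<phi> s + \<phi>' s * (t - s)" using pos[OF t(1)] by simp
  have "((b - a) / 2)\<^sup>2 \<le> \<bar>t - s\<bar>\<^sup>2" using t(2) ab(3) by (intro power_mono) auto
  then have "K / 2 * ((b - a) / 2)\<^sup>2 \<le> K / 2 * (t - s)\<^sup>2" using K(2) by simp
  moreover have "\<phi>' s * (t - s) \<le> \<bar>\<phi>' s\<bar> * (2 * M)"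
  proof -
    have "\<phi>' s * (t - s) \<le> \<bar>\<phi>' s\<bar> * \<bar>t - s\<bar>" by (metis abs_ge_self abs_mult)
    also have "\<bar>t - s\<bar> \<le> 2 * M" using JM[OF s] JM[OF t(1)] by (simp add: abs_le_iff)
    finally show ?thesis by (simp add: mult_left_mono)
  qed
  ultimately have "K / 2 * ((b - a) / 2)\<^sup>2 \<le> \<phi> s + \<bar>\<phi>' s\<bar> * (2 * M)" using 1 by linarith
  then show ?thesis by (simp add: power_divide mult_ac)
qed

section \<open>Integral identities from the equation and from stability\<close>

context bounded_solution
begin

text \<open>The equation tested with \<open>g (u x) * (\<eta> x)^2\<close>: the integrand is the
  divergence of \<open>(\<eta> x)^2 * g (u x)\<close> times \<open>p x\<close>.\<close>

lemma potential_identity: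
  assumes \<eta>: "\<And>x. GDERIV \<eta> x :> z x" and cz: "continuous_on UNIV z"
    and 0: "\<And>x. norm x > r \<Longrightarrow> \<eta> x = 0"
  shows "(\<integral>x. (\<eta> x)\<^sup>2 * (g' (u x) * (norm (p x))\<^sup>2 + (g (u x))\<^sup>2)
      + 2 * \<eta> x * g (u x) * (p x \<bullet> z x) \<partial>lborel) = 0"
proof -
  define V where "V b x = ((\<eta> x * \<eta> x) * g (u x)) * (p x \<bullet> b)" for b x
  define d where "d b x = ((\<eta> x * \<eta> x) * g (u x)) *\<^sub>R q b x
    + (p x \<bullet> b) *\<^sub>R ((\<eta> x * \<eta> x) *\<^sub>R (g' (u x) *\<^sub>R p x) + g (u x) *\<^sub>R (\<eta> x *\<^sub>R z x + \<eta> x *\<^sub>R z x))" for b x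
  have "(\<integral>x. (\<Sum>b\<in>Basis. d b x \<bullet> b) \<partial>lborel) = 0"
  proof (rule integral_divergence_0)
    show "GDERIV (V b) x :> d b x" if "b \<in> Basis" for b x
      unfolding V_def d_def by (intro GDERIV_mult \<eta> q that GDERIV_DERIV_compose[OF u g])
    show "continuous_on UNIV (d b)" if "b \<in> Basis" for b
      unfolding d_def
      by (intro continuous_intros cp cz GDERIV_continuous_on[OF \<eta>] cq that cgu cg'u)
    show "V b x = 0" if "norm x > r" for b x by (simp add: V_def 0 that)
  qed
  moreover have "(\<Sum>b\<in>Basis. d b x \<bullet> b) = (\<eta> x)\<^sup>2 * (g' (u x) * (norm (p x))\<^sup>2 + (g (u x))\<^sup>2)
      + 2 * \<eta> x * g (u x) * (p x \<bullet> z x)" for x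
  proof -
    have "(\<Sum>b\<in>Basis. d b x \<bullet> b) = ((\<eta> x * \<eta> x) * g (u x)) * (\<Sum>b\<in>Basis. q b x \<bullet> b)
        + (\<eta> x * \<eta> x * g' (u x)) * (\<Sum>b\<in>Basis. (p x \<bullet> b) * (p x \<bullet> b))
        + (2 * g (u x) * \<eta> x) * (\<Sum>b\<in>Basis. (p x \<bullet> b) * (z x \<bullet> b))"
      unfolding d_def
      by (simp add: inner_add_left sum.distrib sum_distrib_left algebra_simps)
    then show ?thesis unfolding euclidean_inner[symmetric] eq power2_norm_eq_inner
      by (simp add: power2_eq_square algebra_simps)
  qed
  ultimately show ?thesis by simp
qed

text \<open>Stability is tested with \<open>v = \<phi>(u) * \<eta>\<close>,
  \<open>\<phi> = sqrt G\<close>. Subtracting half of \<open>potential_identity\<close>, whose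
  integral is 0, removes the cross term in \<open>p x \<bullet> z x\<close>; what remains factors,
  with \<open>- \<phi>'' * \<phi>\<close> in front of
  \<open>(norm (p x))^2 - 2 * G (u x)\<close>.\<close>

lemma stability_identity:
  assumes st: "stable_under G u" and pos: "\<And>x. G (u x) > 0"
    and \<eta>: "\<And>x. GDERIV \<eta> x :> z x" and cz: "continuous_on UNIV z"
    and 0: "\<And>x. norm x > r \<Longrightarrow> \<eta> x = 0"
  shows "0 \<le> (\<integral>x. G (u x) * (norm (z x))\<^sup>2
      + (\<eta> x)\<^sup>2 * (((g (u x))\<^sup>2 / (4 * G (u x)) - g' (u x) / 2) * ((norm (p x))\<^sup>2 - 2 * G (u x))) \<partial>lborel)"
proof -
  have z0: "z x = 0" if "norm x > r" for x using GDERIV_0_outside[OF \<eta> 0 that] .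
  note c\<eta> = GDERIV_continuous_on[OF \<eta>]
  note [continuous_intros] = cp cgu cg'u cGu continuous_on_subset[OF cz subset_UNIV] c\<eta>
  define v where "v x = sqrt (G (u x)) * \<eta> x" for x
  define dv where "dv x = sqrt (G (u x)) *\<^sub>R z x + \<eta> x *\<^sub>R ((g (u x) / (2 * sqrt (G (u x)))) *\<^sub>R p x)" for x
  have v: "GDERIV v x :> dv x" for x
    unfolding v_def dv_def
    by (intro GDERIV_mult \<eta> GDERIV_DERIV_compose[OF u DERIV_sqrt_twice(1)[OF G g pos]])
  have sq0: "sqrt (G (u x)) \<noteq> 0" "G (u x) \<noteq> 0" for x using pos[of x] by simp_all
  have cdv: "continuous_on UNIV dv"
    unfolding dv_def using sq0 by (intro continuous_intros) auto
  have "{x. v x \<noteq> 0} \<subseteq> cball 0 r"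
    unfolding v_def using 0 by (force simp: not_le[symmetric])
  then have "compact (closure {x. v x \<noteq> 0})"
    unfolding compact_closure by (rule bounded_subset[OF bounded_cball])
  then have Q: "0 \<le> second_variation G u v"
    using st C1_of_GDERIV(1)[OF v cdv] unfolding stable_under_def by blast
  have "deriv G = g" by (intro ext DERIV_imp_deriv[OF G])
  then have dG: "deriv (deriv G) = g'" by (simp add: ext[OF DERIV_imp_deriv[OF g]])
  define Q where "Q x = (norm (dv x))\<^sup>2 + g' (u x) * (v x)\<^sup>2" for x
  define A where "A x = (\<eta> x)\<^sup>2 * (g' (u x) * (norm (p x))\<^sup>2 + (g (u x))\<^sup>2)
      + 2 * \<eta> x * g (u x) * (p x \<bullet> z x)" for x
  have "second_variation G u v = (\<integral>x. Q x \<partial>lborel)"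
    unfolding second_variation_def C1_of_GDERIV(2)[OF v cdv] dG Q_def ..
  then have Q0: "0 \<le> (\<integral>x. Q x \<partial>lborel)" using Q by simp
  have A0: "(\<integral>x. A x \<partial>lborel) = 0" unfolding A_def by (rule potential_identity[OF \<eta> cz 0])
  have iQ: "integrable lborel Q"
    unfolding Q_def v_def dv_def
    by (rule integrable_compact_support[of _ r])
       (use sq0 in \<open>auto intro!: continuous_intros simp: 0 z0\<close>)
  have iA: "integrable lborel A"
    unfolding A_def
    by (rule integrable_compact_support[of _ r]) (auto intro!: continuous_intros simp: 0)
  have "(\<integral>x. Q x - A x / 2 \<partial>lborel) = (\<integral>x. Q x \<partial>lborel) - (\<integral>x. A x \<partial>lborel) / 2"
    using iQ iA by simp
  also have "\<dots> \<ge> 0" using Q0 A0 by simp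
  finally have "0 \<le> (\<integral>x. Q x - A x / 2 \<partial>lborel)" .
  moreover have "Q x - A x / 2 = G (u x) * (norm (z x))\<^sup>2
      + (\<eta> x)\<^sup>2 * (((g (u x))\<^sup>2 / (4 * G (u x)) - g' (u x) / 2) * ((norm (p x))\<^sup>2 - 2 * G (u x)))" for x
  proof -
    define w where "w = sqrt (G (u x))"
    have w: "w > 0" "G (u x) = w * w" using pos[of x] by (auto simp: w_def)
    have "(norm (dv x))\<^sup>2 = (w *\<^sub>R z x + \<eta> x *\<^sub>R ((g (u x) / (2 * w)) *\<^sub>R p x))
        \<bullet> (w *\<^sub>R z x + \<eta> x *\<^sub>R ((g (u x) / (2 * w)) *\<^sub>R p x))"
      by (simp add: dv_def power2_norm_eq_inner w_def)
    also have "\<dots> = (w * w) * (z x \<bullet> z x) + \<eta> x * g (u x) * (p x \<bullet> z x)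
        + (\<eta> x)\<^sup>2 * ((g (u x))\<^sup>2 / (4 * (w * w))) * (p x \<bullet> p x)"
      using w(1) by (simp add: inner_add_left inner_add_right inner_commute[of "z x" "p x"]
          power2_eq_square field_simps)
    finally have n: "(norm (dv x))\<^sup>2 = (w * w) * (norm (z x))\<^sup>2 + \<eta> x * g (u x) * (p x \<bullet> z x)
        + (\<eta> x)\<^sup>2 * ((g (u x))\<^sup>2 / (4 * (w * w))) * (norm (p x))\<^sup>2"
      by (simp add: power2_norm_eq_inner)
    have v2: "(v x)\<^sup>2 = (w * w) * (\<eta> x)\<^sup>2"
      by (simp add: v_def w_def[symmetric] power2_eq_square)
    show ?thesis unfolding Q_def A_def n v2 w(2) using w(1)
      by (simp add: field_simps power2_eq_square)
  qed
  ultimately show ?thesis by simp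
qed

end

section \<open>Lower bound for the Dirichlet energy\<close>

context bounded_solution
begin

text \<open>The weighted energy density is bounded pointwise by the Dirichlet density, a lower-order
  error, and multiples of the integrands of \<open>stability_identity\<close> and
  \<open>potential_identity\<close>, whose integrals have a favourable sign or vanish.\<close>

lemma dirichlet_energy_growth:
  assumes st: "stable_under G u" and nc: "\<not> u constant_on UNIV" and K: "K > 0"
    and concave: "\<And>s. s \<in> range u \<Longrightarrow> - deriv (deriv (\<lambda>t. sqrt (G t))) s \<ge> K"
  shows "\<exists>C R\<^sub>0. C > 0 \<and> R\<^sub>0 > 0 \<and>
    (\<forall>R\<ge>R\<^sub>0. C * R ^ (DIM('a) - 1) \<le> (LBINT x:ball 0 R. (norm (p x))\<^sup>2))"
proof -
  have pos: "G (u x) > 0" for x by (rule potential_pos[OF nc])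
  obtain c where c: "c > 0" "\<And>R. R \<ge> 1 \<Longrightarrow> c * R ^ (DIM('a) - 1) \<le> weighted_energy R"
    using weighted_energy_growth[OF nc] by blast
  obtain C where C: "C > 0" "\<And>s. \<bar>s\<bar> \<le> M \<Longrightarrow> \<bar>g' s\<bar> \<le> C"
      "\<And>s. \<bar>s\<bar> \<le> M \<Longrightarrow> (g s)\<^sup>2 \<le> 2 * C * G s"
    using nonneg_derivative_square_le[OF G g cg' G0, of M] by blast
  obtain \<Gamma> where \<Gamma>: "\<Gamma> \<ge> 0" "\<And>s. s \<in> {-M..M} \<Longrightarrow> \<bar>G s\<bar> \<le> \<Gamma>"
    using continuous_bounded_on_interval[OF cG] by blast
  have G\<Gamma>: "G (u x) \<le> \<Gamma>" for x using \<Gamma>(2)[of "u x"] uM[of x] by (auto simp: abs_le_iff)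
  \<comment> \<open>This is \<open>- \<phi>'' * \<phi>\<close> at \<open>u x\<close> for
    \<open>\<phi> = sqrt G\<close>; it lies between \<open>K * \<phi>\<close> and
    \<open>C\<close>.\<close>
  define B where "B x = (g (u x))\<^sup>2 / (4 * G (u x)) - g' (u x) / 2" for x
  have BC: "B x \<le> C" for x
  proof -
    have "(g (u x))\<^sup>2 / (4 * G (u x)) \<le> C / 2"
      using C(3)[OF uM[of x]] pos[of x] by (simp add: field_simps)
    moreover have "- g' (u x) \<le> C" using C(2)[OF uM[of x]] by linarith
    ultimately show ?thesis unfolding B_def by linarith
  qed
  have BK: "K * sqrt (G (u x)) \<le> B x" for x
  proof -
    have "K * sqrt (G (u x)) \<le> - deriv (deriv (\<lambda>t. sqrt (G t))) (u x) * sqrt (G (u x))"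
      using concave[of "u x"] pos[of x] by (intro mult_right_mono) auto
    then show ?thesis using DERIV_sqrt_twice(3)[OF G g pos[of x]] unfolding B_def by simp
  qed
  \<comment> \<open>Where \<open>sqrt G\<close> is not small, its cube controls \<open>G\<close>;
    where it is small, its slope \<open>g / (2 * sqrt G)\<close> is not, and \<open>g^2\<close>
    controls \<open>G\<close>.\<close>
  obtain \<alpha> \<beta> where ab: "\<alpha> \<ge> 0" "\<beta> \<ge> 0"
    "\<And>x. G (u x) \<le> \<alpha> * (G (u x) * sqrt (G (u x))) + \<beta> * (g (u x))\<^sup>2"
  proof -
    obtain x1 x2 where x12: "u x1 < u x2"
      using nc unfolding constant_on_def by (metis linorder_neqE_linordered_idom)
    \<comment> \<open>Concavity is given on the range only; connectedness makes the range an
      interval, and \<open>u x1 < u x2\<close> gives it positive length.\<close>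
    have J: "convex (range u)"
      using connected_continuous_image[OF cu connected_UNIV] by (simp add: is_interval_connected_1 is_interval_convex_1[symmetric])
    have posr: "G s > 0" if "s \<in> range u" for s using that pos by auto
    define \<kappa> where "\<kappa> = K * (u x2 - u x1)\<^sup>2 / 8"
    have \<kappa>: "\<kappa> > 0" using K x12 by (simp add: \<kappa>_def)
    have vs: "\<kappa> \<le> sqrt (G s) + 2 * M * \<bar>g s / (2 * sqrt (G s))\<bar>" if "s \<in> range u" for s
      unfolding \<kappa>_def
    proof (rule concave_value_or_slope[OF J _ _ _ K _ _ _ _ x12 that])
      show "DERIV (\<lambda>t. sqrt (G t)) s :> g s / (2 * sqrt (G s))" if "s \<in> range u" for s
        by (rule DERIV_sqrt_twice(1)[OF G g posr[OF that]])
      show "DERIV (\<lambda>t. g t / (2 * sqrt (G t))) s :> deriv (deriv (\<lambda>t. sqrt (G t))) s"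
        if "s \<in> range u" for s
        by (rule DERIV_sqrt_twice(2)[OF G g posr[OF that]])
      show "deriv (deriv (\<lambda>t. sqrt (G t))) s \<le> - K" if "s \<in> range u" for s
        using concave[OF that] by simp
    qed (use G0 uM in auto)
    have M: "M \<ge> 0" using uM[of 0] by linarith
    show ?thesis
    proof
      show "2 / \<kappa> \<ge> 0" "4 * M\<^sup>2 / (4 * \<kappa>\<^sup>2) \<ge> 0" using \<kappa> by auto
      show "G (u x) \<le> (2 / \<kappa>) * (G (u x) * sqrt (G (u x))) + (4 * M\<^sup>2 / (4 * \<kappa>\<^sup>2)) * (g (u x))\<^sup>2" for x
      proof -
        define w where "w = sqrt (G (u x))"
        have w: "w > 0" "G (u x) = w * w" using pos[of x] by (auto simp: w_def)
        have "\<kappa> \<le> w + M * \<bar>g (u x)\<bar> / w"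
          using vs[of "u x"] w by (simp add: w_def[symmetric] abs_mult)
        then have "\<kappa> * (w * w) \<le> (w + M * \<bar>g (u x)\<bar> / w) * (w * w)"
          using w by (intro mult_right_mono) auto
        also have "\<dots> = w * w * w + w * (M * \<bar>g (u x)\<bar>)" using w by (simp add: field_simps)
        \<comment> \<open>Young's inequality; half of \<open>\<kappa> * (w * w)\<close> is absorbed
          on the left.\<close>
        also have "w * (M * \<bar>g (u x)\<bar>) \<le> \<kappa> / 2 * (w * w) + (M * \<bar>g (u x)\<bar>)\<^sup>2 / (2 * \<kappa>)"
        proof -
          have "0 \<le> (\<kappa> * w - M * \<bar>g (u x)\<bar>)\<^sup>2 / (2 * \<kappa>)" using \<kappa> by simp
          also have "\<dots> = \<kappa> / 2 * (w * w) + (M * \<bar>g (u x)\<bar>)\<^sup>2 / (2 * \<kappa>) - w * (M * \<bar>g (u x)\<bar>)"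
            using \<kappa> by (simp add: power2_eq_square field_simps)
          finally show ?thesis by simp
        qed
        finally have "\<kappa> / 2 * (w * w) \<le> w * w * w + M\<^sup>2 * (g (u x))\<^sup>2 / (2 * \<kappa>)"
          by (simp add: power_mult_distrib)
        then have "2 / \<kappa> * (\<kappa> / 2 * (w * w)) \<le> 2 / \<kappa> * (w * w * w + M\<^sup>2 * (g (u x))\<^sup>2 / (2 * \<kappa>))"
          using \<kappa> by (intro mult_left_mono) auto
        then show ?thesis unfolding w_def[symmetric] unfolding w(2) using \<kappa>
          by (simp add: distrib_left power2_eq_square)
      qed
    qed
  qed
  \<comment> \<open>Chosen so that \<open>a * (2 * K) = \<alpha>\<close>, to match the left-hand
    side of \<open>t1\<close> below.\<close>
  define a where "a = \<alpha> / (2 * K)"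
  have a0: "a \<ge> 0" using ab(1) K by (simp add: a_def)
  \<comment> \<open>The summands come from the half in \<open>energy_density\<close>, from
    \<open>t1\<close> and from \<open>t2\<close>; \<open>C6 / R^2\<close> is the error in
    \<open>t1\<close> due to the gradient of the cut-off.\<close>
  define C5 where "C5 = 1 / 2 + a * C + \<beta> * (2 * C + 64)"
  define C6 where "C6 = a * \<Gamma> * 16"
  have C5: "C5 > 0" unfolding C5_def using a0 C(1) ab(2) by (intro add_pos_nonneg) auto
  have C6: "C6 \<ge> 0" using a0 \<Gamma> by (simp add: C6_def)
  define \<omega> where "\<omega> = measure lborel (ball (0::'a) 1)"
  have \<omega>: "\<omega> \<ge> 0" by (simp add: \<omega>_def)
  \<comment> \<open>The error has order \<open>R\<close> to the power \<open>DIM('a) - 2\<close>;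
    the division by \<open>R\<close> avoids truncated subtraction in dimension one.\<close>
  have main: "c * R ^ (DIM('a) - 1)
      \<le> C5 * (LBINT x:ball 0 R. (norm (p x))\<^sup>2) + C6 * \<omega> * R ^ (DIM('a) - 1) / R" if R: "R \<ge> 1" for R
  proof -
    let ?\<eta> = "\<lambda>x::'a. (cutoff R x)\<^sup>2"
    let ?z = "\<lambda>x::'a. (- 4 * cutoff R x / R\<^sup>2) *\<^sub>R x"
    have R0: "R > 0" using R by simp
    have out: "cutoff R x = 0" if "norm x > R" for x :: 'a using cutoff_outside[OF R0, of x] that by simp
    note [continuous_intros] = continuous_on_cutoff cp continuous_energy_density cgu cg'u cGu
    have cz: "continuous_on UNIV ?z" using R0 by (intro continuous_intros) auto
    define A where "A x = (?\<eta> x)\<^sup>2 * (g' (u x) * (norm (p x))\<^sup>2 + (g (u x))\<^sup>2)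
      + 2 * ?\<eta> x * g (u x) * (p x \<bullet> ?z x)" for x
    define S where "S x = G (u x) * (norm (?z x))\<^sup>2
      + (?\<eta> x)\<^sup>2 * (B x * ((norm (p x))\<^sup>2 - 2 * G (u x)))" for x
    have A0: "(\<integral>x. A x \<partial>lborel) = 0" unfolding A_def
      by (rule potential_identity[OF GDERIV_cutoff_square cz, of R]) (simp add: out)
    have S0: "0 \<le> (\<integral>x. S x \<partial>lborel)" unfolding S_def B_def
      by (rule stability_identity[OF st pos GDERIV_cutoff_square cz, of R]) (simp add: out)
    have iA: "integrable lborel A" unfolding A_def
      using R0 by (intro integrable_compact_support[of _ R] continuous_intros) (auto simp: out)
    have iS: "integrable lborel S" unfolding S_def B_def
      using R0 pos by (intro integrable_compact_support[of _ R] continuous_intros)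
        (auto simp: out less_imp_neq[symmetric])
    have iE: "integrable lborel (\<lambda>x. (cutoff R x)^4 * energy_density x)"
      by (intro integrable_compact_support[of _ R] continuous_intros) (auto simp: out)
    have iP: "set_integrable lborel (ball 0 R) (\<lambda>x. (norm (p x))\<^sup>2)"
    proof (rule set_integrable_subset)
      show "set_integrable lborel (cball 0 R) (\<lambda>x. (norm (p x))\<^sup>2)"
        unfolding set_integrable_def by (intro borel_integrable_compact continuous_intros) auto
    qed auto
    have i1: "integrable lborel (\<lambda>x::'a. indicator (ball 0 R) x *\<^sub>R (C6 / R\<^sup>2))"
      using emeasure_lborel_ball_finite[of "0::'a" R] by (intro integrable_scaleR_left) simp
    \<comment> \<open>\<open>S\<close> and \<open>A\<close> stay in the pointwise bound because
      after integration \<open>- a * S\<close> contributes at most 0 and \<open>A\<close>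
      contributes 0.\<close>
    have pw: "(cutoff R x)^4 * energy_density x \<le>
        C5 * (indicator (ball 0 R) x *\<^sub>R (norm (p x))\<^sup>2) + indicator (ball 0 R) x *\<^sub>R (C6 / R\<^sup>2)
        - a * S x + 2 * \<beta> * A x" for x
    proof (cases "x \<in> ball 0 R")
      case False
      then have "cutoff R x = 0" using cutoff_outside[OF R0, of x] by simp
      then show ?thesis using False by (simp add: S_def A_def)
    next
      case True
      then have xR: "norm x < R" by simp
      define P where "P = (norm (p x))\<^sup>2"
      define Z where "Z = (norm (?z x))\<^sup>2"
      define h where "h = ?\<eta> x"
      define w where "w = sqrt (G (u x))"
      define \<gamma> where "\<gamma> = g (u x)"
      have w: "w > 0" "G (u x) = w * w" using pos[of x] by (auto simp: w_def)
      have P: "P \<ge> 0" by (simp add: P_def)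
      have h: "0 \<le> h\<^sup>2" "h\<^sup>2 \<le> 1" "(cutoff R x)^4 = h\<^sup>2"
        using cutoff_nonneg[of R x] cutoff_le_1[of R x]
        by (auto simp: h_def power_le_one simp flip: power_mult)
      \<comment> \<open>The decaying bound feeds the error in \<open>t1\<close>; the constant 16 is
        enough in \<open>t2\<close>, where \<open>Z\<close> is multiplied by
        \<open>P\<close>.\<close>
      have Z: "0 \<le> Z" "Z \<le> 16 / R\<^sup>2" "Z \<le> 16"
      proof -
        have "norm (?z x) = 4 * cutoff R x * norm x / R\<^sup>2"
          using cutoff_nonneg[of R x] by simp
        also have "\<dots> \<le> 4 * 1 * R / R\<^sup>2"
          using cutoff_le_1[of R x] cutoff_nonneg[of R x] xR R0 by (intro divide_right_mono mult_mono) auto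
        also have "\<dots> = 4 / R" by (simp add: power2_eq_square)
        finally have "Z \<le> (4 / R)\<^sup>2" unfolding Z_def by (intro power_mono) auto
        then show 1: "Z \<le> 16 / R\<^sup>2" by (simp add: power_divide)
        have "16 / R\<^sup>2 \<le> 16 / 1" using R by (intro divide_left_mono) auto
        then show "Z \<le> 16" using 1 by simp
      qed (simp add: Z_def)
      have S': "S x = w * w * Z + h\<^sup>2 * (B x * P) - 2 * (h\<^sup>2 * (B x * (w * w)))"
        unfolding S_def P_def[symmetric] Z_def[symmetric] h_def[symmetric] w(2) by (simp add: algebra_simps)
      define Y where "Y = p x \<bullet> ?z x"
      have A': "A x = h\<^sup>2 * (g' (u x) * P) + h\<^sup>2 * \<gamma>\<^sup>2 + 2 * h * \<gamma> * Y"
        unfolding A_def Y_def[symmetric] P_def[symmetric] h_def[symmetric] \<gamma>_def[symmetric] by (simp add: algebra_simps)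
      \<comment> \<open>Solves the stability integrand for its last term, with
        \<open>B x \<ge> K * w\<close> there and \<open>B x \<le> C\<close> in front of
        \<open>P\<close>.\<close>
      have t1: "2 * K * (h\<^sup>2 * (w * w * w)) \<le> C * P + \<Gamma> * (16 / R\<^sup>2) - S x"
      proof -
        have "h\<^sup>2 * ((K * w) * (w * w)) \<le> h\<^sup>2 * (B x * (w * w))"
          using BK[of x, folded w_def] h w(1) by (intro mult_left_mono mult_right_mono) auto
        moreover have "h\<^sup>2 * (B x * P) \<le> 1 * (C * P)"
        proof -
          have "h\<^sup>2 * (B x * P) \<le> h\<^sup>2 * (C * P)"
            using BC[of x] h P by (intro mult_left_mono mult_right_mono) auto
          also have "\<dots> \<le> 1 * (C * P)" using h P C(1) by (intro mult_right_mono) auto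
          finally show ?thesis .
        qed
        moreover have "w * w * Z \<le> \<Gamma> * (16 / R\<^sup>2)"
          using G\<Gamma>[of x] Z \<Gamma>(1) w by (intro mult_mono) auto
        ultimately show ?thesis unfolding S' by (simp add: algebra_simps)
      qed
      have t2: "h\<^sup>2 * \<gamma>\<^sup>2 \<le> 2 * A x + (2 * C + 64) * P"
      proof -
        have "h\<^sup>2 * (- g' (u x) * P) \<le> 1 * (C * P)"
        proof -
          have "h\<^sup>2 * (- g' (u x) * P) \<le> h\<^sup>2 * (C * P)"
            using C(2)[OF uM[of x]] h P by (intro mult_left_mono mult_right_mono) auto
          also have "\<dots> \<le> 1 * (C * P)" using h P C(1) by (intro mult_right_mono) auto
          finally show ?thesis .
        qed
        \<comment> \<open>Absorbing \<open>h^2 * \<gamma>^2 / 2\<close> on the left doubles the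
          other terms, so \<open>2 * Y^2 \<le> 32 * P\<close> accounts for the 64 in
          \<open>t2\<close>.\<close>
        moreover have "- (2 * h * \<gamma> * Y) \<le> h\<^sup>2 * \<gamma>\<^sup>2 / 2 + 2 * Y\<^sup>2"
        proof -
          have "0 \<le> (h * \<gamma> + 2 * Y)\<^sup>2 / 2" by simp
          also have "\<dots> = h\<^sup>2 * \<gamma>\<^sup>2 / 2 + 2 * Y\<^sup>2 + 2 * h * \<gamma> * Y"
            by (simp only: power2_eq_square) (simp add: field_simps)
          finally show ?thesis by simp
        qed
        moreover have "Y\<^sup>2 \<le> P * 16"
        proof -
          have "Y\<^sup>2 \<le> P * Z"
            unfolding Y_def P_def Z_def power2_norm_eq_inner by (rule Cauchy_Schwarz_ineq)
          also have "\<dots> \<le> P * 16" using P Z by (intro mult_left_mono) auto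
          finally show ?thesis .
        qed
        ultimately show ?thesis unfolding A' by (simp add: algebra_simps)
      qed
      have "(cutoff R x)^4 * energy_density x = h\<^sup>2 * P / 2 + h\<^sup>2 * (w * w)"
        unfolding h(3) energy_density_def P_def[symmetric] w(2) by (simp add: algebra_simps)
      also have "h\<^sup>2 * P \<le> 1 * P" using h P by (intro mult_right_mono) auto
      also have "h\<^sup>2 * (w * w) \<le> h\<^sup>2 * (\<alpha> * (w * w * w) + \<beta> * \<gamma>\<^sup>2)"
        using ab(3)[of x, folded w_def \<gamma>_def, unfolded w(2)] h by (intro mult_left_mono) auto
      also have "\<dots> = a * (2 * K * (h\<^sup>2 * (w * w * w))) + \<beta> * (h\<^sup>2 * \<gamma>\<^sup>2)"
        using K by (simp add: a_def field_simps)
      also have "\<dots> \<le> a * (C * P + \<Gamma> * (16 / R\<^sup>2) - S x) + \<beta> * (2 * A x + (2 * C + 64) * P)"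
        using t1 t2 a0 ab(2) by (intro add_mono mult_left_mono)
      finally show ?thesis using True
        by (simp add: P_def[symmetric] C5_def C6_def algebra_simps)
    qed
    have "weighted_energy R \<le> (\<integral>x. C5 * (indicator (ball 0 R) x *\<^sub>R (norm (p x))\<^sup>2)
        + indicator (ball 0 R) x *\<^sub>R (C6 / R\<^sup>2) - a * S x + 2 * \<beta> * A x \<partial>lborel)"
      unfolding weighted_energy_def
      by (intro integral_mono pw iE Bochner_Integration.integrable_add Bochner_Integration.integrable_diff
          integrable_mult_right iA iS i1 iP[unfolded set_integrable_def])
    also have "\<dots> = C5 * (LBINT x:ball 0 R. (norm (p x))\<^sup>2)
        + (\<integral>x. indicator (ball (0::'a) R) x *\<^sub>R (C6 / R\<^sup>2) \<partial>lborel)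
        - a * (\<integral>x. S x \<partial>lborel) + 2 * \<beta> * (\<integral>x. A x \<partial>lborel)"
      unfolding set_lebesgue_integral_def using iA iS i1 iP[unfolded set_integrable_def] by simp
    also have "\<dots> \<le> C5 * (LBINT x:ball 0 R. (norm (p x))\<^sup>2)
        + (\<integral>x. indicator (ball (0::'a) R) x *\<^sub>R (C6 / R\<^sup>2) \<partial>lborel)"
      using A0 S0 a0 by simp
    also have "(\<integral>x. indicator (ball (0::'a) R) x *\<^sub>R (C6 / R\<^sup>2) \<partial>lborel) = measure lborel (ball (0::'a) R) * (C6 / R\<^sup>2)"
      using emeasure_lborel_ball_finite[of "0::'a" R] by simp
    also have "measure lborel (ball (0::'a) R) = R ^ DIM('a) * \<omega>"
      unfolding \<omega>_def using R0 by (intro content_ball_conv_unit_ball) simp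
    also have "R ^ DIM('a) * \<omega> * (C6 / R\<^sup>2) = C6 * \<omega> * R ^ (DIM('a) - 1) / R"
    proof -
      have "R ^ DIM('a) = R * R ^ (DIM('a) - 1)" by (simp add: power_eq_if)
      then show ?thesis using R0 by (simp add: power2_eq_square)
    qed
    finally show ?thesis using c(2)[OF R] by linarith
  qed
  \<comment> \<open>From this radius on the error is at most half of
    \<open>c * R ^ (DIM('a) - 1)\<close>.\<close>
  define R0 where "R0 = 1 + 2 * C6 * \<omega> / c"
  have R0: "R0 \<ge> 1" using C6 \<omega> c(1) by (simp add: R0_def)
  show ?thesis
  proof (intro exI conjI allI impI)
    show "c / (2 * C5) > 0" using c(1) C5 by simp
    show "R0 > 0" using R0 by simp
    fix R assume R: "R \<ge> R0"
    have "2 * C6 * \<omega> / c \<le> R" using R unfolding R0_def by simp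
    then have "C6 * \<omega> \<le> c / 2 * R" using c(1) by (simp add: field_simps)
    then have "C6 * \<omega> / R \<le> c / 2" using R R0 by (simp add: field_simps)
    then have "C6 * \<omega> / R * R ^ (DIM('a) - 1) \<le> c / 2 * R ^ (DIM('a) - 1)"
      using R R0 by (intro mult_right_mono) auto
    then have "C6 * \<omega> * R ^ (DIM('a) - 1) / R \<le> c / 2 * R ^ (DIM('a) - 1)" by simp
    then have "c / 2 * R ^ (DIM('a) - 1) \<le> C5 * (LBINT x:ball 0 R. (norm (p x))\<^sup>2)"
      using main[of R] R R0 by linarith
    then show "c / (2 * C5) * R ^ (DIM('a) - 1) \<le> (LBINT x:ball 0 R. (norm (p x))\<^sup>2)"
      using C5 by (simp add: field_simps)
  qed
qed

end

section \<open>Passage from the definitions of the statement to the locale\<close>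

text \<open>On the real line \<open>partial_deriv 1\<close> is \<open>deriv\<close>, so
  \<open>C2 G\<close> provides the two ordinary derivatives of \<open>G\<close>; the Hessian rows
  are the gradients of the partial derivatives of \<open>u\<close>.\<close>

lemma bounded_solution_of_is_solution:
  fixes u :: "'a::euclidean_space \<Rightarrow> real"
  assumes G: "C2 G" "\<And>s. G s \<ge> 0" and u: "is_solution G u" and M: "\<And>x. \<bar>u x\<bar> \<le> M"
  shows "bounded_solution u (grad u) (\<lambda>b. grad (partial_deriv b u)) G (deriv G) (deriv (deriv G)) M"
proof -
  have C1G: "C1 G" and "C1 (partial_deriv 1 G)" using G(1) by (auto simp: C2_def)
  moreover have "partial_deriv 1 G = deriv G"
    using C1G by (simp add: fun_eq_iff C1_def partial_deriv_real)
  ultimately have C1g: "C1 (deriv G)" by simp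
  have D: "DERIV f s :> deriv f s" and c: "continuous_on UNIV (deriv f)" if "C1 f" for f :: "real \<Rightarrow> real" and s
  proof -
    show "DERIV f s :> deriv f s"
      using that by (metis C1_def DERIV_imp_deriv real_differentiable_def)
    have "partial_deriv 1 f = deriv f" using that by (simp add: fun_eq_iff C1_def partial_deriv_real)
    then show "continuous_on UNIV (deriv f)" using that by (auto simp: C1_def)
  qed
  have C1u: "C1 u" and C1p: "\<And>b. b \<in> Basis \<Longrightarrow> C1 (partial_deriv b u)"
    using u by (auto simp: is_solution_def C2_def)
  show ?thesis
  proof
    show "GDERIV u x :> grad u x" for x by (rule C1_GDERIV[OF C1u])
    show "GDERIV (\<lambda>x. grad u x \<bullet> b) x :> grad (partial_deriv b u) x" if "b \<in> Basis" for b x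
      using C1_GDERIV[OF C1p[OF that], of x] by (simp add: partial_deriv_eq_grad[OF C1u, symmetric])
    show "continuous_on UNIV (grad (partial_deriv b u))" if "b \<in> Basis" for b
      by (rule C1_continuous_grad[OF C1p[OF that]])
    show "(\<Sum>b\<in>Basis. grad (partial_deriv b u) x \<bullet> b) = deriv G (u x)" for x
      using u by (auto simp: is_solution_def laplacian_def partial_deriv_eq_grad[OF C1p])
  qed (use D c C1G C1g G M in auto)
qed

theorem proposition1p4:
  fixes G :: "real \<Rightarrow> real" and u :: "real ^ 'n \<Rightarrow> real" and K :: real
  assumes "C2 G" and "\<And>s. G s \<ge> 0"
    and "is_solution G u" and "stable_under G u"
    and "\<not> u constant_on UNIV" and "bounded (range u)"
    and "K > 0" and "\<And>s. s \<in> range u \<Longrightarrow> - deriv (deriv (\<lambda>t. sqrt (G t))) s \<ge> K"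
  shows "\<exists>C R\<^sub>0. C > 0 \<and> R\<^sub>0 > 0 \<and>
    (\<forall>R\<ge>R\<^sub>0. (LBINT x:ball 0 R. (norm (grad u x))\<^sup>2) \<ge> C * R ^ (CARD('n) - 1))"
proof -
  obtain M where M: "\<And>x. \<bar>u x\<bar> \<le> M"
    using assms(6) unfolding bounded_iff by auto
  interpret bounded_solution u "grad u" "\<lambda>b. grad (partial_deriv b u)" G "deriv G" "deriv (deriv G)" M
    by (rule bounded_solution_of_is_solution[OF assms(1-3) M])
  show ?thesis
    using dirichlet_energy_growth[OF assms(4,5,7,8)] by simp
qed

end
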